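(* Let $\tau$ be an untwisted skew product with group factor $\mathbb Z^d$ and base shift $(\Sigma,\sigma)$ a transitive subshift of finite type. The following are equivalent: (a) $\tau$ is transitive; (b) $\tau$ has the ftp and $0\in\mathrm{Int}(\mathrm{rot}(\tau))$; (c) $\tau$ has the ftp and its periodic points are dense in $\Sigma\times\mathbb Z^d$.
   Context: Countable state Markov shift $(\Sigma,\sigma)$: countable state set $S$, $\{0,1\}$-matrix $C$ with finite row/column sums, $\Sigma=\{s\in S^{\mathbb Z}:C_{s_is_{i+1}}=1\ \forall i\}$, product of discrete topologies, $\sigma$ left shift; subshift of finite type if $S$ finite. Untwisted skew product: $\tau:\Sigma\times\mathbb Z^d\to\Sigma\times\mathbb Z^d$, $\tau(s,n)=(\sigma(s),n+h(s))$, where $h:\Sigma\to\mathbb Z^d$ depends only on $(s_0,s_1)$. For a subgroup $\Gamma$, $\tau_\Gamma(s,n+\Gamma)=(\sigma(s),n+h(s)+\Gamma)$. $\tau$ has the ftp (finite transitivity property) if $\tau_\Gamma$ is transitive for every finite-index subgroup $\Gamma\subset\mathbb Z^d$. Transitive: for all nonempty open $U,V$ some $n\in\mathbb Z$ has $\tau^n(U)\cap V\ne\emptyset$. $h(s,n)=\sum_{i=0}^{n-1}h(\sigma^is)$; $\mathrm{rot}(s)=\lim_{n\to\infty}h(s,n)/n\in\mathbb R^d$ when it exists; $\mathrm{rot}(\tau)=\{\mathrm{rot}(s)\}$; interior in $\mathbb R^d$.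
   Formalization: The base Σ is assumed infinite. For a finite base the claim can fail: with one state, d=1 and h=1, τ is transitive with the ftp, but rot(τ)={1} has empty interior and τ has no periodic points. A finite nonempty transitive base is a single periodic orbit. *)

theory Defs
  imports "HOL-Analysis.Analysis"
begin

text \<open>Base shift: finite state set 's (the type), transition matrix C given as a
  boolean relation (C a b = True iff the {0,1}-matrix entry is 1).\<close>

definition SFT :: "('s \<Rightarrow> 's \<Rightarrow> bool) \<Rightarrow> (int \<Rightarrow> 's) set" where
  "SFT C = {s. \<forall>i. C (s i) (s (i + 1))}"

definition lshift :: "(int \<Rightarrow> 's) \<Rightarrow> (int \<Rightarrow> 's)" where
  "lshift s = (\<lambda>i. s (i + 1))"

definition SFT_top :: "('s \<Rightarrow> 's \<Rightarrow> bool) \<Rightarrow> (int \<Rightarrow> 's) topology" where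
  "SFT_top C = subtopology (product_topology (\<lambda>_. discrete_topology UNIV) UNIV) (SFT C)"

text \<open>Topological transitivity of an invertible map f on X: for all nonempty open U, V
  some integer n has f^n(U) meeting V.  For n \<ge> 0 this is (f^^n) U \<inter> V; for n = -m < 0,
  f^(-m)(U) \<inter> V \<noteq> {} iff U \<inter> f^m(V) \<noteq> {}.\<close>
definition dyn_transitive :: "'a topology \<Rightarrow> ('a \<Rightarrow> 'a) \<Rightarrow> bool" where
  "dyn_transitive X f \<longleftrightarrow>
     (\<forall>U V. openin X U \<and> openin X V \<and> U \<noteq> {} \<and> V \<noteq> {} \<longrightarrow>
        (\<exists>n::nat. (f ^^ n) ` U \<inter> V \<noteq> {} \<or> U \<inter> (f ^^ n) ` V \<noteq> {}))"

definition skew :: "('s \<Rightarrow> 's \<Rightarrow> int ^ 'd) \<Rightarrow> (int \<Rightarrow> 's) \<times> (int ^ 'd) \<Rightarrow> (int \<Rightarrow> 's) \<times> (int ^ 'd)" where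
  "skew h0 = (\<lambda>(s, n). (lshift s, n + h0 (s 0) (s 1)))"

definition skew_top :: "('s \<Rightarrow> 's \<Rightarrow> bool) \<Rightarrow> ((int \<Rightarrow> 's) \<times> (int ^ 'd)) topology" where
  "skew_top C = prod_topology (SFT_top C) (discrete_topology UNIV)"

definition cosets :: "(int ^ 'd) set \<Rightarrow> (int ^ 'd) set set" where
  "cosets G = range (\<lambda>n. (\<lambda>g. n + g) ` G)"

definition finite_index_subgroup :: "(int ^ 'd) set \<Rightarrow> bool" where
  "finite_index_subgroup G \<longleftrightarrow> 0 \<in> G \<and> (\<forall>x\<in>G. \<forall>y\<in>G. x + y \<in> G \<and> - x \<in> G)
      \<and> finite (cosets G)"

definition skew_quot :: "('s \<Rightarrow> 's \<Rightarrow> int ^ 'd) \<Rightarrow> (int ^ 'd) set \<Rightarrow>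
    (int \<Rightarrow> 's) \<times> (int ^ 'd) set \<Rightarrow> (int \<Rightarrow> 's) \<times> (int ^ 'd) set" where
  "skew_quot h0 G = (\<lambda>(s, c). (lshift s, (\<lambda>x. x + h0 (s 0) (s 1)) ` c))"

definition skew_quot_top :: "('s \<Rightarrow> 's \<Rightarrow> bool) \<Rightarrow> (int ^ 'd) set \<Rightarrow>
    ((int \<Rightarrow> 's) \<times> (int ^ 'd) set) topology" where
  "skew_quot_top C G = prod_topology (SFT_top C) (discrete_topology (cosets G))"

definition ftp :: "('s \<Rightarrow> 's \<Rightarrow> bool) \<Rightarrow> ('s \<Rightarrow> 's \<Rightarrow> int ^ 'd) \<Rightarrow> bool" where
  "ftp C h0 \<longleftrightarrow> (\<forall>G. finite_index_subgroup G \<longrightarrow> dyn_transitive (skew_quot_top C G) (skew_quot h0 G))"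

definition hsum :: "('s \<Rightarrow> 's \<Rightarrow> int ^ 'd) \<Rightarrow> (int \<Rightarrow> 's) \<Rightarrow> nat \<Rightarrow> int ^ 'd" where
  "hsum h0 s n = (\<Sum>i<n. h0 (s (int i)) (s (int i + 1)))"

definition real_vec :: "int ^ 'd \<Rightarrow> real ^ 'd" where
  "real_vec v = (\<chi> j. real_of_int (v $ j))"

definition rot_set :: "('s \<Rightarrow> 's \<Rightarrow> bool) \<Rightarrow> ('s \<Rightarrow> 's \<Rightarrow> int ^ 'd) \<Rightarrow> (real ^ 'd) set" where
  "rot_set C h0 = {r. \<exists>s\<in>SFT C. (\<lambda>n. (1 / real n) *\<^sub>R real_vec (hsum h0 s n)) \<longlonglongrightarrow> r}"

definition periodic_pts :: "('s \<Rightarrow> 's \<Rightarrow> bool) \<Rightarrow> ('s \<Rightarrow> 's \<Rightarrow> int ^ 'd) \<Rightarrow> ((int \<Rightarrow> 's) \<times> (int ^ 'd)) set" where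
  "periodic_pts C h0 = {x \<in> SFT C \<times> UNIV. \<exists>p::nat. p \<ge> 1 \<and> (skew h0 ^^ p) x = x}"

end

theory Submission
  imports Defs "HOL-Library.Z2"
begin

text \<open>
  Let \<open>M \<subseteq> \<int>\<^sup>d\<close> be the monoid of weights (values of the cocycle \<open>h\<close>) of the loops at a fixed state in
  the transition graph. The skew product is transitive iff the graph is irreducible and
  \<open>M = \<int>\<^sup>d\<close>, and the ftp gives irreducibility together with \<open>M + N\<int>\<^sup>d = \<int>\<^sup>d\<close> for all \<open>N \<ge> 1\<close>.
  Hence \<open>M - M = \<int>\<^sup>d\<close>, so some \<open>m + {-1,0,1}\<^sup>d\<close> lies in \<open>M\<close>, and it remains to find a loop whose weight
  is close enough to a negative multiple of \<open>m\<close>. Under (b) it is obtained by closing up a long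
  piece of an orbit with rotation vector \<open>-m/q\<close>; under (c) a periodic point that runs through a loop
  of weight \<open>m\<close> completes it by a loop of weight \<open>-m\<close>.

  Transitivity as defined here allows negative times. It yields arbitrarily large positive return
  times because the ftp excludes isolated points of the base: an isolated point would have to be
  periodic, and then the base would be finite.
\<close>

section \<open>Transitivity and return times\<close>

text \<open>A nonempty open set in a Hausdorff space without isolated points contains two disjoint
  nonempty open sets. Transitivity between them gives a nonzero time, and iterating gives
  arbitrarily late returns of any open set to itself. Such a return of the points of
  \<open>U\<close> that reach \<open>V\<close>, or of the points of \<open>V\<close> that reach
  \<open>U\<close>, gives a late passage from \<open>U\<close> to \<open>V\<close>.\<close>

lemma dyn_transitive_late_return:
  assumes trans: "dyn_transitive X f" and cont: "continuous_map X X f"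
    and haus: "Hausdorff_space X" and perfect: "\<And>x. \<not> openin X {x}"
    and U: "openin X U" "U \<noteq> {}" and V: "openin X V" "V \<noteq> {}"
  shows "\<exists>n\<ge>N. \<exists>x\<in>U. (f ^^ n) x \<in> V"
proof -
  have cont_pow: "continuous_map X X (f ^^ n)" for n
    
  proof (induction n)
    case (Suc n)
    then show ?case unfolding funpow.simps by (rule continuous_map_compose[OF _ cont])
  qed (simp add: id_def)
  have preim: "openin X {x \<in> A. (f ^^ n) x \<in> B}" if "openin X A" "openin X B" for A B n
  proof -
    have "{x \<in> A. (f ^^ n) x \<in> B} = A \<inter> {x \<in> topspace X. (f ^^ n) x \<in> B}"
      using openin_subset[OF that(1)] by auto
    then show ?thesis
      using openin_continuous_map_preimage[OF cont_pow that(2)] that(1) by auto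
  qed
  have return1: "\<exists>n\<ge>1. \<exists>x\<in>W. (f ^^ n) x \<in> W" if W: "openin X W" "W \<noteq> {}" for W
  proof -
    obtain x where x: "x \<in> W" using W by auto
    have "W \<noteq> {x}" using perfect W by auto
    then obtain y where y: "y \<in> W" "y \<noteq> x" using x by blast
    have "x \<in> topspace X" "y \<in> topspace X" using x y openin_subset[OF W(1)] by auto
    then obtain A B where AB: "openin X A" "openin X B" "x \<in> A" "y \<in> B" "disjnt A B"
      using haus y(2) unfolding Hausdorff_space_def by metis
    have o: "openin X (W \<inter> A)" "openin X (W \<inter> B)" "W \<inter> A \<noteq> {}" "W \<inter> B \<noteq> {}"
      using AB W x y by auto
    then obtain n where
      n: "(f ^^ n) ` (W \<inter> A) \<inter> (W \<inter> B) \<noteq> {} \<or> (W \<inter> A) \<inter> (f ^^ n) ` (W \<inter> B) \<noteq> {}"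
      using trans unfolding dyn_transitive_def by metis
    \<comment> \<open>Time 0 is excluded by disjointness, and the direction of time is irrelevant
      because both pieces lie in \<open>W\<close>.\<close>
    have "n \<noteq> 0"
      using n AB(5) by (auto simp: disjnt_iff)
    moreover have "\<exists>x\<in>W. (f ^^ n) x \<in> W" using n by auto
    ultimately show ?thesis
      by (metis One_nat_def Suc_leI gr0I)
  qed
  have return: "\<exists>n\<ge>k. \<exists>x\<in>W. (f ^^ n) x \<in> W" if W: "openin X W" "W \<noteq> {}" for W k
  proof (induction k)
    case 0
    show ?case using return1[OF W] by blast
  next
    case (Suc k)
    then obtain n where n: "n \<ge> k" "{x \<in> W. (f ^^ n) x \<in> W} \<noteq> {}" by auto
    \<comment> \<open>A return of the set of points that return at time \<open>n\<close> adds its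
      own time \<open>l\<close> to \<open>n\<close>.\<close>
    obtain l x where l: "l \<ge> 1" and x: "x \<in> {x \<in> W. (f ^^ n) x \<in> W}"
      "(f ^^ l) x \<in> {x \<in> W. (f ^^ n) x \<in> W}"
      using return1[OF preim[OF W(1) W(1)] n(2)] by auto
    have "(f ^^ (n + l)) x \<in> W" using x by (auto simp: funpow_add)
    then show ?case using x n(1) l by (intro exI[of _ "n + l"]) auto
  qed
  obtain n where "(f ^^ n) ` U \<inter> V \<noteq> {} \<or> U \<inter> (f ^^ n) ` V \<noteq> {}"
    using trans U V unfolding dyn_transitive_def by metis
  then show ?thesis
  proof
    assume "(f ^^ n) ` U \<inter> V \<noteq> {}"
    then have "{x \<in> U. (f ^^ n) x \<in> V} \<noteq> {}" by auto
    from return[OF preim[OF U(1) V(1)] this, of N] obtain k x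
      where "k \<ge> N" "x \<in> U" "(f ^^ n) ((f ^^ k) x) \<in> V" by auto
    then show ?thesis by (intro exI[of _ "n + k"]) (auto simp: funpow_add)
  next
    assume "U \<inter> (f ^^ n) ` V \<noteq> {}"
    then have "{x \<in> V. (f ^^ n) x \<in> U} \<noteq> {}" by auto
    \<comment> \<open>The orbit visits \<open>V\<close>, then \<open>U\<close> at time
      \<open>n\<close>, then \<open>V\<close> again at time \<open>k\<close>; the margin
      \<open>n\<close> makes the passage time \<open>k - n\<close> at least
      \<open>N\<close>.\<close>
    from return[OF preim[OF V(1) U(1)] this, of "N + n"] obtain k x
      where k: "k \<ge> N + n" "(f ^^ n) x \<in> U" "(f ^^ k) x \<in> V" by auto
    have "(f ^^ k) x = (f ^^ (k - n)) ((f ^^ n) x)"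
      using k(1) by (metis add_leD2 comp_apply funpow_add le_add_diff_inverse2)
    then show ?thesis using k by (intro exI[of _ "k - n"]) auto
  qed
qed

section \<open>Topology of the shift and its extensions\<close>

text \<open>The symmetric windows give a neighbourhood base at each point of the shift, so openness
  is tested by a single number \<open>N\<close>.\<close>

definition cyl :: "('s \<Rightarrow> 's \<Rightarrow> bool) \<Rightarrow> (int \<Rightarrow> 's) \<Rightarrow> nat \<Rightarrow> (int \<Rightarrow> 's) set" where
  "cyl C s N = {t \<in> SFT C. \<forall>i. \<bar>i\<bar> \<le> int N \<longrightarrow> t i = s i}"

lemma topspace_SFT_top [simp]: "topspace (SFT_top C) = SFT C"
  by (simp add: SFT_top_def)

lemma cyl_subset: "cyl C s N \<subseteq> SFT C"
  by (auto simp: cyl_def)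

lemma self_in_cyl: "s \<in> SFT C \<Longrightarrow> s \<in> cyl C s N"
  by (auto simp: cyl_def)

lemma openin_cyl: "openin (SFT_top C) (cyl C s N)"
proof -
  let ?B = "PiE UNIV (\<lambda>i::int. if \<bar>i\<bar> \<le> int N then {s i} else UNIV)"
  have "finite {-int N..int N}" by simp
  then have "finite {i. (if \<bar>i\<bar> \<le> int N then {s i} else UNIV) \<noteq> topspace (discrete_topology UNIV)}"
    by (rule finite_subset[rotated]) (auto split: if_splits)
  then have "openin (product_topology (\<lambda>_. discrete_topology UNIV) UNIV) ?B"
    by (intro product_topology_basis) auto
  moreover have "cyl C s N = ?B \<inter> SFT C"
    by (auto simp: cyl_def PiE_iff split: if_splits)
  ultimately show ?thesis
    unfolding SFT_top_def openin_subtopology by blast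
qed

lemma openin_SFT_top_iff:
  "openin (SFT_top C) U \<longleftrightarrow> U \<subseteq> SFT C \<and> (\<forall>s\<in>U. \<exists>N. cyl C s N \<subseteq> U)"
proof (intro iffI conjI ballI)
  assume U: "openin (SFT_top C) U"
  show "U \<subseteq> SFT C" using openin_subset[OF U] by simp
  fix s assume s: "s \<in> U"
  from U obtain T where T: "openin (product_topology (\<lambda>_. discrete_topology UNIV) UNIV) T"
    "U = T \<inter> SFT C" unfolding SFT_top_def openin_subtopology by auto
  have "s \<in> T" using s T(2) by simp
  with T(1)[unfolded openin_product_topology_alt, rule_format, of s]
  obtain B where B: "finite {i. B i \<noteq> UNIV}" "s \<in> PiE UNIV B" "PiE UNIV B \<subseteq> T"
    by auto
  from B(1) have "finite ((\<lambda>i. nat \<bar>i\<bar>) ` {i::int. B i \<noteq> UNIV})" by simp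
  then obtain N where N: "\<And>i::int. B i \<noteq> UNIV \<Longrightarrow> nat \<bar>i\<bar> \<le> N"
    unfolding finite_nat_set_iff_bounded_le by blast
  have "t i \<in> B i" if "t \<in> cyl C s N" for t i
  proof (cases "B i = UNIV")
    case False
    then have "t i = s i" using N[OF False] that unfolding cyl_def by auto
    then show ?thesis using B(2) by auto
  qed auto
  then have "t \<in> T" if "t \<in> cyl C s N" for t
    using that B(3) by (meson PiE_UNIV_domain UNIV_I PiE_I subsetD)
  then have "cyl C s N \<subseteq> U"
    using T(2) cyl_subset[of C s N] by blast
  then show "\<exists>N. cyl C s N \<subseteq> U" ..
next
  assume *: "U \<subseteq> SFT C \<and> (\<forall>s\<in>U. \<exists>N. cyl C s N \<subseteq> U)"
  have "\<exists>T. openin (SFT_top C) T \<and> s \<in> T \<and> T \<subseteq> U" if "s \<in> U" for s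
    using * that openin_cyl self_in_cyl by (meson subsetD)
  then show "openin (SFT_top C) U"
    using openin_subopen[of "SFT_top C" U] by blast
qed

lemma openin_SFT_prod_iff:
  "openin (prod_topology (SFT_top C) (discrete_topology K)) U \<longleftrightarrow>
     U \<subseteq> SFT C \<times> K \<and> (\<forall>s c. (s, c) \<in> U \<longrightarrow> (\<exists>N. cyl C s N \<times> {c} \<subseteq> U))"
proof (intro iffI conjI allI impI)
  assume U: "openin (prod_topology (SFT_top C) (discrete_topology K)) U"
  show "U \<subseteq> SFT C \<times> K" using openin_subset[OF U] by simp
  fix s c assume "(s, c) \<in> U"
  then obtain A B where A: "openin (SFT_top C) A" "s \<in> A" and B: "c \<in> B" "A \<times> B \<subseteq> U"
    using U unfolding openin_prod_topology_alt by metis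
  then obtain N where "cyl C s N \<subseteq> A" unfolding openin_SFT_top_iff by metis
  then show "\<exists>N. cyl C s N \<times> {c} \<subseteq> U" using B by blast
next
  assume *: "U \<subseteq> SFT C \<times> K \<and> (\<forall>s c. (s, c) \<in> U \<longrightarrow> (\<exists>N. cyl C s N \<times> {c} \<subseteq> U))"
  show "openin (prod_topology (SFT_top C) (discrete_topology K)) U"
    unfolding openin_prod_topology_alt
  proof (intro allI impI)
    fix s c assume sc: "(s, c) \<in> U"
    with * obtain N where N: "cyl C s N \<times> {c} \<subseteq> U" by blast
    have "s \<in> SFT C" "c \<in> K" using * sc by auto
    then show "\<exists>A B. openin (SFT_top C) A \<and> openin (discrete_topology K) B \<and> s \<in> A \<and> c \<in> B \<and> A \<times> B \<subseteq> U"
      using N by (intro exI[of _ "cyl C s N"] exI[of _ "{c}"]) (auto simp: openin_cyl self_in_cyl)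
  qed
qed

lemma openin_cyl_prod: "c \<in> K \<Longrightarrow> openin (prod_topology (SFT_top C) (discrete_topology K)) (cyl C s N \<times> {c})"
  by (simp add: openin_prod_Times_iff openin_cyl)

lemma lshift_in_SFT: "s \<in> SFT C \<Longrightarrow> lshift s \<in> SFT C"
  unfolding SFT_def lshift_def mem_Collect_eq by blast

text \<open>Treats \<open>skew\<close> and all the maps \<open>skew_quot\<close> at once:
  \<open>K\<close> is the fibre and \<open>A\<close> the update of the fibre coordinate.\<close>

lemma continuous_map_skew_like:
  assumes "\<And>x y c. c \<in> K \<Longrightarrow> A x y c \<in> K"
    and F: "F = (\<lambda>(s, c). (lshift s, A (s 0) (s 1) c))"
  shows "continuous_map (prod_topology (SFT_top C) (discrete_topology K))
           (prod_topology (SFT_top C) (discrete_topology K)) F"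
proof -
  let ?T = "prod_topology (SFT_top C) (discrete_topology K)"
  have "openin ?T {x \<in> topspace ?T. F x \<in> U}" if U: "openin ?T U" for U
  proof -
    have "\<exists>N. cyl C s N \<times> {c} \<subseteq> {x \<in> topspace ?T. F x \<in> U}"
      if sc: "(s, c) \<in> {x \<in> topspace ?T. F x \<in> U}" for s c
    proof -
      have "(lshift s, A (s 0) (s 1) c) \<in> U" using sc F by auto
      then obtain N where N: "cyl C (lshift s) N \<times> {A (s 0) (s 1) c} \<subseteq> U"
        using U unfolding openin_SFT_prod_iff by metis
      \<comment> \<open>The window grows by one: the shift reads one coordinate further, and
        coordinate 1 enters the fibre update.\<close>
      have "lshift t \<in> cyl C (lshift s) N \<and> t 0 = s 0 \<and> t 1 = s 1"
        if "t \<in> cyl C s (Suc N)" for t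
        using that lshift_in_SFT[of t C] by (auto simp: cyl_def lshift_def)
      then have "cyl C s (Suc N) \<times> {c} \<subseteq> {x \<in> topspace ?T. F x \<in> U}"
        using N sc cyl_subset[of C s "Suc N"] F by force
      then show ?thesis by blast
    qed
    then show ?thesis unfolding openin_SFT_prod_iff[of C K "{x \<in> topspace ?T. F x \<in> U}"] by auto
  qed
  moreover have "F \<in> topspace ?T \<rightarrow> topspace ?T"
    using assms lshift_in_SFT by auto
  ultimately show ?thesis unfolding continuous_map_def by blast
qed

lemma Hausdorff_SFT_prod: "Hausdorff_space (prod_topology (SFT_top C) (discrete_topology K))"
  by (simp add: Hausdorff_space_prod_topology Hausdorff_space_product_topology SFT_top_def
      Hausdorff_space_subtopology)

text \<open>As cylinders form a neighbourhood base, this says that the shift has no isolated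
  points.\<close>

definition perfect_SFT :: "('s \<Rightarrow> 's \<Rightarrow> bool) \<Rightarrow> bool" where
  "perfect_SFT C \<longleftrightarrow> (\<forall>s\<in>SFT C. \<forall>N. cyl C s N \<noteq> {s})"

lemma perfect_SFT_prod:
  assumes "perfect_SFT C"
  shows "\<not> openin (prod_topology (SFT_top C) (discrete_topology K)) {x}"
proof
  obtain s c where x: "x = (s, c)" by (cases x)
  assume "openin (prod_topology (SFT_top C) (discrete_topology K)) {x}"
  then have *: "{(s, c)} \<subseteq> SFT C \<times> K"
      "\<forall>s' c'. (s', c') \<in> {(s, c)} \<longrightarrow> (\<exists>N. cyl C s' N \<times> {c'} \<subseteq> {(s, c)})"
    unfolding openin_SFT_prod_iff x by simp_all
  from *(1) have s: "s \<in> SFT C" by simp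
  from *(2) obtain N where "cyl C s N \<times> {c} \<subseteq> {(s, c)}" by blast
  then have "cyl C s N \<subseteq> {s}" by blast
  then have "cyl C s N = {s}" using self_in_cyl[OF s] by auto
  then show False using assms s unfolding perfect_SFT_def by auto
qed

lemma late_return_skew_like:
  assumes F: "F = (\<lambda>(s, c). (lshift s, A (s 0) (s 1) c))"
    and A: "\<And>x y c. c \<in> K \<Longrightarrow> A x y c \<in> K"
    and perfect: "perfect_SFT C"
    and trans: "dyn_transitive (prod_topology (SFT_top C) (discrete_topology K)) F"
    and "s \<in> SFT C" "t \<in> SFT C" "c \<in> K" "e \<in> K"
  obtains n u where "n \<ge> k" "u \<in> cyl C s N" "(F ^^ n) (u, c) \<in> cyl C t N \<times> {e}"
proof -
  have "cyl C s N \<times> {c} \<noteq> {}" "cyl C t N \<times> {e} \<noteq> {}"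
    using self_in_cyl[OF assms(5)] self_in_cyl[OF assms(6)] by auto
  from dyn_transitive_late_return[OF trans continuous_map_skew_like[OF A F] Hausdorff_SFT_prod
      perfect_SFT_prod[OF perfect] openin_cyl_prod[OF assms(7)] this(1) openin_cyl_prod[OF assms(8)] this(2)]
  obtain n z where nz: "n \<ge> k" "z \<in> cyl C s N \<times> {c}" "(F ^^ n) z \<in> cyl C t N \<times> {e}" by metis
  obtain u where "z = (u, c)" "u \<in> cyl C s N" using nz(2) by auto
  then show ?thesis using that[OF nz(1)] nz(3) by simp
qed

section \<open>Iterates and cocycle sums\<close>

lemma lshift_funpow: "(lshift ^^ n) s = (\<lambda>i. s (i + int n))"
  by (induction n) (auto simp: lshift_def fun_eq_iff add_ac)

lemma hsum_0 [simp]: "hsum h s 0 = 0"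
  by (simp add: hsum_def)

lemma hsum_Suc: "hsum h s (Suc n) = hsum h s n + h (s (int n)) (s (int n + 1))"
  by (simp add: hsum_def)

lemma hsum_add: "hsum h s (m + n) = hsum h s m + hsum h (\<lambda>i. s (i + int m)) n"
  by (induction n) (auto simp: hsum_Suc algebra_simps)

lemma hsum_cong:
  assumes "\<And>i. 0 \<le> i \<Longrightarrow> i \<le> int n \<Longrightarrow> s i = t i"
  shows "hsum h s n = hsum h t n"
  using assms by (auto simp: hsum_def intro!: sum.cong)

lemma skew_funpow: "(skew h ^^ n) (s, x) = ((lshift ^^ n) s, x + hsum h s n)"
proof (induction n)
  case (Suc n)
  then have "(skew h ^^ Suc n) (s, x) = skew h (\<lambda>i. s (i + int n), x + hsum h s n)"
    by (simp add: lshift_funpow)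
  then show ?case
    unfolding lshift_funpow skew_def by (simp add: lshift_def hsum_Suc add_ac)
qed simp

lemma skew_quot_coset:
  "skew_quot h G (s, (\<lambda>g. x + g) ` G) = (lshift s, (\<lambda>g. x + h (s 0) (s 1) + g) ` G)"
  by (auto simp: skew_quot_def image_image algebra_simps)

lemma skew_quot_funpow:
  "(skew_quot h G ^^ n) (s, (\<lambda>g. x + g) ` G) = ((lshift ^^ n) s, (\<lambda>g. x + hsum h s n + g) ` G)"
proof (induction n)
  case (Suc n)
  then have "(skew_quot h G ^^ Suc n) (s, (\<lambda>g. x + g) ` G) =
      skew_quot h G (\<lambda>i. s (i + int n), (\<lambda>g. x + hsum h s n + g) ` G)"
    by (simp add: lshift_funpow)
  then show ?case
    unfolding lshift_funpow skew_quot_coset by (simp add: lshift_def hsum_Suc add_ac)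
qed simp

text \<open>Each \<open>skew_quot h G\<close> is a factor of \<open>skew h\<close> under the
  projection \<open>p\<close>, and transitivity passes to factors: nonempty open sets are pulled
  back to nonempty open sets.\<close>

lemma ftp_of_dyn_transitive:
  assumes trans: "dyn_transitive (skew_top C) (skew h)"
  shows "ftp C h"
  unfolding ftp_def
proof (intro allI impI)
  fix G :: "(int ^ 'b) set"
  define p where "p = (\<lambda>(s :: int \<Rightarrow> 'a, x :: int ^ 'b). (s, (\<lambda>g. x + g) ` G))"
  have pull: "openin (skew_top C) {z \<in> SFT C \<times> UNIV. p z \<in> U}"
    "{z \<in> SFT C \<times> UNIV. p z \<in> U} \<noteq> {}"
    if U: "openin (skew_quot_top C G) U" "U \<noteq> {}" for U
  proof -
    have U1: "U \<subseteq> SFT C \<times> cosets G"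
      and U2: "\<And>s c. (s, c) \<in> U \<Longrightarrow> \<exists>N. cyl C s N \<times> {c} \<subseteq> U"
      using U(1) unfolding skew_quot_top_def openin_SFT_prod_iff by blast+
    have "\<exists>N. cyl C s N \<times> {x} \<subseteq> {z \<in> SFT C \<times> UNIV. p z \<in> U}"
      if "(s, x) \<in> {z \<in> SFT C \<times> UNIV. p z \<in> U}" for s x
    proof -
      have "(s, (\<lambda>g. x + g) ` G) \<in> U" using that by (simp add: p_def)
      from U2[OF this] obtain N where N: "cyl C s N \<times> {(\<lambda>g. x + g) ` G} \<subseteq> U" ..
      have "(t, x) \<in> {z \<in> SFT C \<times> UNIV. p z \<in> U}" if "t \<in> cyl C s N" for t
      proof -
        have "(t, (\<lambda>g. x + g) ` G) \<in> U" using that N by blast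
        then show ?thesis using that cyl_subset[of C s N] by (auto simp: p_def)
      qed
      then show ?thesis by blast
    qed
    then show "openin (skew_top C) {z \<in> SFT C \<times> UNIV. p z \<in> U}"
      unfolding skew_top_def openin_SFT_prod_iff by blast
    obtain s c where sc: "(s, c) \<in> U" using U(2) by (metis ex_in_conv surj_pair)
    then obtain x where "c = (\<lambda>g. x + g) ` G" "s \<in> SFT C" using U1 unfolding cosets_def by blast
    then have "(s, x) \<in> {z \<in> SFT C \<times> UNIV. p z \<in> U}" using sc by (simp add: p_def)
    then show "{z \<in> SFT C \<times> UNIV. p z \<in> U} \<noteq> {}" by blast
  qed
  have semi: "p ((skew h ^^ n) z) = (skew_quot h G ^^ n) (p z)" for n z
  proof -
    obtain s x where "z = (s, x)" by (cases z)
    then show ?thesis by (simp only: p_def prod.case skew_funpow skew_quot_funpow)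
  qed
  show "dyn_transitive (skew_quot_top C G) (skew_quot h G)"
    unfolding dyn_transitive_def
  proof (intro allI impI, elim conjE)
    fix U V assume U: "openin (skew_quot_top C G) U" "U \<noteq> {}"
      and V: "openin (skew_quot_top C G) V" "V \<noteq> {}"
    define U' where "U' = {z \<in> SFT C \<times> UNIV. p z \<in> U}"
    define V' where "V' = {z \<in> SFT C \<times> UNIV. p z \<in> V}"
    have "openin (skew_top C) U'" "U' \<noteq> {}" "openin (skew_top C) V'" "V' \<noteq> {}"
      unfolding U'_def V'_def by (rule pull[OF U] pull[OF V])+
    with trans[unfolded dyn_transitive_def, rule_format, of U' V']
    obtain n where "(skew h ^^ n) ` U' \<inter> V' \<noteq> {} \<or> U' \<inter> (skew h ^^ n) ` V' \<noteq> {}"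
      by metis
    then have "(skew_quot h G ^^ n) ` U \<inter> V \<noteq> {} \<or> U \<inter> (skew_quot h G ^^ n) ` V \<noteq> {}"
    proof
      assume "(skew h ^^ n) ` U' \<inter> V' \<noteq> {}"
      then obtain z where "z \<in> U'" "(skew h ^^ n) z \<in> V'" by blast
      then have "p z \<in> U" "p ((skew h ^^ n) z) \<in> V" unfolding U'_def V'_def by simp_all
      then show ?thesis unfolding semi by blast
    next
      assume "U' \<inter> (skew h ^^ n) ` V' \<noteq> {}"
      then obtain z where "z \<in> V'" "(skew h ^^ n) z \<in> U'" by blast
      then have "p z \<in> V" "p ((skew h ^^ n) z) \<in> U" unfolding U'_def V'_def by simp_all
      then show ?thesis unfolding semi by blast
    qed
    then show "\<exists>n. (skew_quot h G ^^ n) ` U \<inter> V \<noteq> {} \<or> U \<inter> (skew_quot h G ^^ n) ` V \<noteq> {}" ..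
  qed
qed

section \<open>Submonoids of the integer lattice\<close>

lemma det_of_int:
  fixes A :: "int ^ 'n ^ 'n"
  shows "det (\<chi> i j. of_int (A $ i $ j) :: 'a :: comm_ring_1 ^ 'n ^ 'n) = of_int (det A)"
  by (simp add: det_def of_int_sum of_int_prod)

text \<open>Reduction modulo 2, carried out in the field \<open>bit\<close>, turns \<open>A\<close>
  into the identity matrix.\<close>

lemma odd_det_if_cong_mat_1:
  fixes A :: "int ^ 'n ^ 'n"
  assumes "\<And>i j. even (A $ i $ j - mat 1 $ i $ j)"
  shows "odd (det A)"
proof
  assume "even (det A)"
  have eq: "(of_int (A $ i $ j) :: bit) = mat 1 $ i $ j" for i j
  proof -
    obtain z where "A $ i $ j - mat 1 $ i $ j = 2 * z" using assms[of i j] by (rule evenE)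
    then have "(of_int (A $ i $ j - mat 1 $ i $ j) :: bit) = 0" by simp
    then have "(of_int (A $ i $ j) :: bit) = of_int (mat 1 $ i $ j)" by (simp only: of_int_diff right_minus_eq)
    then show ?thesis by (simp add: mat_def)
  qed
  have "(of_int (det A) :: bit) = det (mat 1 :: bit ^ 'n ^ 'n)"
    unfolding det_of_int[symmetric] by (intro arg_cong[where f = det]) (simp add: vec_eq_iff eq)
  then have "(of_int (det A) :: bit) = 1" by simp
  with \<open>even (det A)\<close> show False by (auto elim!: evenE)
qed

text \<open>Over the reals, Cramer's rule solves the system with right-hand side \<open>b\<close> by
  integer determinants divided by \<open>det A\<close>; clearing this denominator leaves an integer
  vector.\<close>

lemma int_cramer:
  fixes A :: "int ^ 'n ^ 'n"
  assumes "det A \<noteq> 0"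
  shows "\<exists>x. A *v x = det A *s b"
proof -
  let ?R = "\<lambda>v :: int ^ 'n. (\<chi> i. real_of_int (v $ i))"
  define A' where "A' = (\<chi> i j. real_of_int (A $ i $ j))"
  define x where "x = (\<chi> k. det (\<chi> i j. if j = k then b $ i else A $ i $ j))"
  have dA: "det A' = real_of_int (det A)" unfolding A'_def by (rule det_of_int)
  define y where "y = (\<chi> k. det (\<chi> i j. if j = k then (?R b) $ i else A' $ i $ j) / det A')"
  have "A' *v y = ?R b"
    using cramer[of A' y "?R b"] assms dA unfolding y_def by simp
  moreover have "y $ k = real_of_int (x $ k) / real_of_int (det A)" for k
  proof -
    have "(\<chi> i j. if j = k then (?R b) $ i else A' $ i $ j) =
      (\<chi> i j. real_of_int ((\<chi> i j. if j = k then b $ i else A $ i $ j) $ i $ j))"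
      by (simp add: vec_eq_iff A'_def)
    then have "det (\<chi> i j. if j = k then (?R b) $ i else A' $ i $ j) = real_of_int (x $ k)"
      using det_of_int[of "\<chi> i j. if j = k then b $ i else A $ i $ j", where 'a = real]
      unfolding x_def by (simp only: vec_lambda_beta)
    then show ?thesis unfolding y_def by (simp add: dA)
  qed
  ultimately have "(\<Sum>k\<in>UNIV. real_of_int (A $ i $ k) * (real_of_int (x $ k) / real_of_int (det A))) = real_of_int (b $ i)" for i
    by (auto simp: matrix_vector_mult_def vec_eq_iff A'_def)
  then have "(\<Sum>k\<in>UNIV. real_of_int (A $ i $ k) * real_of_int (x $ k)) / real_of_int (det A) = real_of_int (b $ i)" for i
    by (simp add: sum_divide_distrib)
  then have "real_of_int (\<Sum>k\<in>UNIV. A $ i $ k * x $ k) = real_of_int (det A * b $ i)" for i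
    using assms by (simp add: field_simps)
  then have "A *v x = det A *s b"
    by (simp only: matrix_vector_mult_def vec_eq_iff of_int_eq_iff vec_lambda_beta vector_smult_component) simp
  then show ?thesis ..
qed

lemma finite_int_box: "finite {v :: int ^ 'd. \<forall>j. v $ j \<in> {a..b}}"
proof -
  have "{v :: int ^ 'd. \<forall>j. v $ j \<in> {a..b}} \<subseteq> vec_lambda ` (PiE UNIV (\<lambda>_. {a..b}))"
  proof
    fix v :: "int ^ 'd" assume "v \<in> {v. \<forall>j. v $ j \<in> {a..b}}"
    then show "v \<in> vec_lambda ` (PiE UNIV (\<lambda>_. {a..b}))"
      by (intro image_eqI[of _ _ "vec_nth v"]) auto
  qed
  then show ?thesis by (rule finite_subset) (intro finite_imageI finite_PiE, auto)
qed

section \<open>When a submonoid or subgroup is the whole lattice\<close>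

lemma of_nat_smult_in_submonoid:
  fixes M :: "(int ^ 'd) set"
  assumes "0 \<in> M" "\<And>x y. x \<in> M \<Longrightarrow> y \<in> M \<Longrightarrow> x + y \<in> M" "m \<in> M"
  shows "int n *s m \<in> M"
  by (induction n) (use assms in \<open>auto simp: vector_sadd_rdistrib\<close>)

lemma sum_in_submonoid:
  assumes "0 \<in> M" "\<And>x y. x \<in> M \<Longrightarrow> y \<in> M \<Longrightarrow> x + y \<in> M" "\<And>i. i \<in> I \<Longrightarrow> f i \<in> M"
  shows "sum f I \<in> M"
  using assms(3)
proof (induction I rule: infinite_finite_induct)
qed (use assms(1,2) in auto)

text \<open>Vectors \<open>m\<^sub>j \<in> G\<close> congruent to the unit vectors modulo 2 form a matrix whose determinant
  is odd; by Cramer's rule \<open>G\<close> then contains a full sublattice \<open>D\<int>\<^sup>d\<close>, and \<open>G + D\<int>\<^sup>d = \<int>\<^sup>d\<close>.\<close>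
lemma subgroup_eq_UNIV_if_dense:
  fixes G :: "(int ^ 'd) set"
  assumes G0: "0 \<in> G" and Gadd: "\<And>x y. x \<in> G \<Longrightarrow> y \<in> G \<Longrightarrow> x + y \<in> G"
    and Gminus: "\<And>x. x \<in> G \<Longrightarrow> - x \<in> G"
    and dense: "\<And>N v. (N :: int) > 0 \<Longrightarrow> \<exists>m\<in>G. \<exists>z. v = m + N *s z"
  shows "G = UNIV"
proof -
  have Gsmult: "c *s m \<in> G" if "m \<in> G" for c m
  proof (cases c)
    case (nonneg n)
    then show ?thesis using of_nat_smult_in_submonoid[OF G0 Gadd that] by simp
  next
    case (neg n)
    have "c *s m = - (int (Suc n) *s m)" using neg by (simp add: vec_eq_iff)
    then show ?thesis using Gminus[OF of_nat_smult_in_submonoid[OF G0 Gadd that, of "Suc n"]] by simp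
  qed
  have "\<forall>j. \<exists>m. m \<in> G \<and> (\<exists>z. axis j 1 = m + 2 *s z)"
    using dense[of 2] by (simp add: Bex_def)
  then obtain m where mG: "\<And>j. m j \<in> G" and m: "\<And>j. \<exists>z. axis j 1 = m j + 2 *s z" by metis
  define A where "A = (\<chi> i j. m j $ i)"
  have "even (A $ i $ j - mat 1 $ i $ j)" for i j
  proof -
    obtain z where z: "axis j 1 = m j + 2 *s z" using m by blast
    have "mat 1 $ i $ j = (axis j 1 :: int ^ 'd) $ i" by (simp add: mat_def axis_def)
    then have "A $ i $ j - mat 1 $ i $ j = 2 * (- z $ i)" unfolding z by (simp add: A_def)
    then show ?thesis by simp
  qed
  then have "odd (det A)" by (rule odd_det_if_cong_mat_1)
  then have det: "det A \<noteq> 0" by auto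
  have DG: "det A *s b \<in> G" for b
  proof -
    obtain x where "A *v x = det A *s b" using int_cramer[OF det] by blast
    moreover have "A *v x = (\<Sum>k\<in>UNIV. x $ k *s m k)"
      by (simp add: matrix_vector_mult_def A_def vec_eq_iff mult.commute)
    moreover have "(\<Sum>k\<in>UNIV. x $ k *s m k) \<in> G"
      using mG Gsmult by (intro sum_in_submonoid[OF G0 Gadd]) auto
    ultimately show ?thesis by simp
  qed
  have "v \<in> G" for v
  proof -
    obtain g z where gz: "g \<in> G" "v = g + \<bar>det A\<bar> *s z"
      using dense[of "\<bar>det A\<bar>" v] det by auto
    \<comment> \<open>The hypothesis \<open>dense\<close> asks for a positive modulus, so the sign
      of the determinant is moved into \<open>z\<close>.\<close>
    have "\<bar>det A\<bar> *s z = det A *s (sgn (det A) *s z)"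
      by (simp add: vec_eq_iff abs_sgn)
    then have "v = g + det A *s (sgn (det A) *s z)" using gz(2) by (simp only:)
    then show ?thesis using Gadd[OF gz(1) DG] by (simp only:)
  qed
  then show ?thesis by auto
qed

text \<open>The vector of signs of \<open>v\<close> is an admissible \<open>w\<close>; splitting it
  off moves every nonzero coordinate of \<open>v\<close> one step towards 0 and uses up one copy of
  \<open>m\<close>.\<close>

lemma ball_in_submonoid:
  fixes M :: "(int ^ 'd) set"
  assumes M0: "0 \<in> M" and Madd: "\<And>x y. x \<in> M \<Longrightarrow> y \<in> M \<Longrightarrow> x + y \<in> M"
    and unit: "\<And>w. (\<And>j. \<bar>w $ j\<bar> \<le> 1) \<Longrightarrow> m + w \<in> M"
    and v: "\<And>j. \<bar>v $ j\<bar> \<le> int k"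
  shows "int k *s m + v \<in> M"
  using v
proof (induction k arbitrary: v)
  case 0
  then have "v = 0" by (simp add: vec_eq_iff)
  then show ?case using M0 by simp
next
  case (Suc k)
  define w where "w = (\<chi> j. sgn (v $ j))"
  have "\<bar>(v - w) $ j\<bar> \<le> int k" for j
    using Suc.prems[of j] by (auto simp: w_def sgn_if)
  then have "int k *s m + (v - w) \<in> M" by (rule Suc.IH)
  moreover have "m + w \<in> M" by (rule unit) (auto simp: w_def sgn_if)
  ultimately have "(int k *s m + (v - w)) + (m + w) \<in> M" by (rule Madd)
  then show ?case by (simp add: vector_sadd_rdistrib algebra_simps)
qed

text \<open>Since \<open>M - M = \<int>\<^sup>d\<close>, some \<open>m0 + {-1,0,1}\<^sup>d\<close> lies in \<open>M\<close>. Its \<open>k\<close>-fold sums contain the ball of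
  radius \<open>k\<close> around \<open>k m0\<close>, and the last hypothesis translates this ball onto a neighbourhood of 0.\<close>
lemma submonoid_eq_UNIV:
  fixes M :: "(int ^ 'd) set"
  assumes M0: "0 \<in> M" and Madd: "\<And>x y. x \<in> M \<Longrightarrow> y \<in> M \<Longrightarrow> x + y \<in> M"
    and dense: "\<And>N v. (N :: int) > 0 \<Longrightarrow> \<exists>m\<in>M. \<exists>z. v = m + N *s z"
    and opposite: "\<And>m. m \<in> M \<Longrightarrow> \<exists>k. \<exists>m'\<in>M. \<forall>j. \<bar>(m' + int k *s m) $ j\<bar> < int k"
  shows "M = UNIV"
proof -
  define G where "G = {x - y | x y. x \<in> M \<and> y \<in> M}"
  have "G = UNIV"
  proof (rule subgroup_eq_UNIV_if_dense)
    show "0 \<in> G" using M0 unfolding G_def by force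
    show "x + y \<in> G" if xy: "x \<in> G" "y \<in> G" for x y
    proof -
      obtain a b c d where "x = a - b" "y = c - d" "a \<in> M" "b \<in> M" "c \<in> M" "d \<in> M"
        using xy unfolding G_def by blast
      then have "x + y = (a + c) - (b + d)" "a + c \<in> M" "b + d \<in> M" using Madd by auto
      then show ?thesis unfolding G_def by blast
    qed
    show "- x \<in> G" if "x \<in> G" for x
      using that unfolding G_def by force
    have "M \<subseteq> G"
    proof
      fix x assume "x \<in> M"
      then show "x \<in> G" using M0 unfolding G_def by (intro CollectI exI[of _ x] exI[of _ 0]) auto
    qed
    then show "\<exists>m\<in>G. \<exists>z. v = m + N *s z" if "N > 0" for N v
      using dense[OF that, of v] by blast
  qed
  then have "\<forall>w. \<exists>x y. x \<in> M \<and> y \<in> M \<and> w = x - y" unfolding G_def by blast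
  then obtain x y where xy: "\<And>w. x w \<in> M" "\<And>w. y w \<in> M" "\<And>w. w = x w - y w" by metis
  define F where "F = {v :: int ^ 'd. \<forall>j. v $ j \<in> {-1..1}}"
  have "finite F" unfolding F_def by (rule finite_int_box)
  define m0 where "m0 = sum y F"
  have m0: "m0 \<in> M" unfolding m0_def using xy(2) by (intro sum_in_submonoid[OF M0 Madd])
  have unit0: "m0 + w \<in> M" if w: "\<And>j. \<bar>w $ j\<bar> \<le> 1" for w
  proof -
    have "w \<in> F" unfolding F_def using w by (auto simp: abs_le_iff minus_le_iff)
    \<comment> \<open>Adding \<open>w\<close> turns the summand \<open>y w\<close> into
      \<open>x w\<close>, which is again in \<open>M\<close>; this is why \<open>m0\<close> sums
      \<open>y\<close> over all of \<open>F\<close>.\<close>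
    then have "m0 = y w + sum y (F - {w})"
      unfolding m0_def using \<open>finite F\<close> by (simp add: sum.remove)
    then have "m0 + w = x w + sum y (F - {w})" using xy(3)[of w] by (simp add: algebra_simps)
    moreover have "sum y (F - {w}) \<in> M" using xy(2) by (intro sum_in_submonoid[OF M0 Madd])
    ultimately show ?thesis using Madd xy(1) by simp
  qed
  obtain k m' where m': "m' \<in> M" "\<And>j. \<bar>(m' + int k *s m0) $ j\<bar> < int k"
    using opposite[OF m0] by auto
  have unit: "0 + w \<in> M" if w: "\<And>j. \<bar>w $ j\<bar> \<le> 1" for w
  proof -
    \<comment> \<open>The strict inequality for \<open>m'\<close> leaves exactly the room needed for
      a \<open>w\<close> with entries of absolute value at most 1.\<close>
    have "\<bar>(w - (m' + int k *s m0)) $ j\<bar> \<le> int k" for j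
      using w[of j] m'(2)[of j] by simp
    then have "int k *s m0 + (w - (m' + int k *s m0)) \<in> M"
      by (intro ball_in_submonoid[OF M0 Madd unit0])
    from Madd[OF m'(1) this] show ?thesis by (simp add: algebra_simps)
  qed
  have "v \<in> M" for v
  proof -
    define k where "k = nat (\<Sum>j\<in>UNIV. \<bar>v $ j\<bar>)"
    have "\<bar>v $ j\<bar> \<le> int k" for j
      unfolding k_def by (simp add: sum_nonneg member_le_sum[of j UNIV "\<lambda>j. \<bar>v $ j\<bar>"])
    with M0 Madd unit have "int k *s 0 + v \<in> M" by (rule ball_in_submonoid)
    then show ?thesis by simp
  qed
  then show ?thesis by auto
qed

section \<open>Consequences of the ftp\<close>

text \<open>These sublattices are the only subgroups to which the ftp is applied.\<close>

definition int_multiples :: "int \<Rightarrow> (int ^ 'd) set" where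
  "int_multiples N = range (\<lambda>z. N *s z)"

lemma finite_index_int_multiples:
  assumes "N > 0"
  shows "finite_index_subgroup (int_multiples N :: (int ^ 'd) set)"
  unfolding finite_index_subgroup_def
proof (intro conjI ballI)
  let ?G = "int_multiples N :: (int ^ 'd) set"
  show "0 \<in> ?G" unfolding int_multiples_def by (rule range_eqI[of _ _ 0]) simp
  fix x y assume "x \<in> ?G" "y \<in> ?G"
  then obtain z w where zw: "x = N *s z" "y = N *s w" unfolding int_multiples_def by blast
  show "x + y \<in> ?G" unfolding int_multiples_def zw
    by (rule range_eqI[of _ _ "z + w"]) (simp add: vector_add_ldistrib)
  show "- x \<in> ?G" unfolding int_multiples_def zw
    by (rule range_eqI[of _ _ "- z"]) (simp add: vec_eq_iff)
next
  let ?G = "int_multiples N :: (int ^ 'd) set"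
  let ?B = "{v :: int ^ 'd. \<forall>j. v $ j \<in> {0..N}}"
  have "cosets ?G \<subseteq> (\<lambda>n. (\<lambda>g. n + g) ` ?G) ` ?B"
  proof
    fix c assume "c \<in> cosets ?G"
    then obtain n where n: "c = (\<lambda>g. n + g) ` ?G" unfolding cosets_def by blast
    define m where "m = (\<chi> j. n $ j mod N)"
    define q where "q = (\<chi> j. n $ j div N)"
    have nm: "n = m + N *s q" by (simp add: vec_eq_iff m_def q_def)
    have z1: "n + N *s z = m + N *s (q + z)" for z
      unfolding nm by (simp add: vec_eq_iff algebra_simps)
    have z2: "m + N *s z = n + N *s (z - q)" for z
      unfolding nm by (simp add: vec_eq_iff algebra_simps)
    have "c = range (\<lambda>z. n + N *s z)" unfolding n int_multiples_def by (simp only: image_image)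
    also have "\<dots> = range (\<lambda>z. m + N *s z)"
    proof (intro equalityI image_subsetI)
      show "n + N *s z \<in> range (\<lambda>z. m + N *s z)" for z unfolding z1 by (rule rangeI)
      show "m + N *s z \<in> range (\<lambda>z. n + N *s z)" for z unfolding z2 by (rule rangeI)
    qed
    finally have "c = (\<lambda>g. m + g) ` ?G" unfolding int_multiples_def by (simp only: image_image)
    moreover have "m \<in> ?B" using assms by (simp add: m_def order_less_imp_le)
    ultimately show "c \<in> (\<lambda>n. (\<lambda>g. n + g) ` ?G) ` ?B" by blast
  qed
  then show "finite (cosets ?G)" by (rule finite_subset) (rule finite_imageI[OF finite_int_box])
qed

lemma translate_coset: "c \<in> cosets G \<Longrightarrow> (\<lambda>z. z + w) ` c \<in> cosets G"
proof -
  assume "c \<in> cosets G"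
  then obtain n where "c = (\<lambda>g. n + g) ` G" unfolding cosets_def by blast
  then have "(\<lambda>z. z + w) ` c = (\<lambda>g. (n + w) + g) ` G" by (simp add: image_image algebra_simps)
  then show ?thesis unfolding cosets_def by blast
qed

lemma coset_eqD:
  fixes x y :: "'a :: monoid_add"
  assumes "(\<lambda>g. x + g) ` G = (\<lambda>g. y + g) ` G" "0 \<in> G"
  shows "\<exists>g\<in>G. y = x + g"
proof -
  have "y \<in> (\<lambda>g. y + g) ` G" by (rule image_eqI[OF _ assms(2)]) simp
  then have "y \<in> (\<lambda>g. x + g) ` G" by (simp only: assms(1))
  then show ?thesis by (elim imageE) (rule bexI)
qed

lemma ftpD:
  assumes "ftp C h" "N > 0"
  shows "dyn_transitive (prod_topology (SFT_top C) (discrete_topology (cosets (int_multiples N))))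
           (skew_quot h (int_multiples N))"
  using assms finite_index_int_multiples unfolding ftp_def skew_quot_top_def by blast

lemma shift_in_SFT: "s \<in> SFT C \<Longrightarrow> (\<lambda>i. s (i + k)) \<in> SFT C"
proof -
  assume "s \<in> SFT C"
  then have "C (s (i + k)) (s (i + k + 1))" for i unfolding SFT_def by blast
  then show ?thesis unfolding SFT_def by (simp add: algebra_simps)
qed

section \<open>Excluding isolated points of the base\<close>

lemma lshift_funpow_eqD: "(lshift ^^ n) t = s \<Longrightarrow> t i = s (i - int n)"
  unfolding lshift_funpow by auto

text \<open>Since \<open>{s}\<close> is open, transitivity makes the orbit of \<open>s\<close>
  dense. The orbit is finite by periodicity, hence closed, so it is the whole shift.\<close>

lemma finite_SFT_if_periodic_isolated:
  assumes trans: "dyn_transitive (SFT_top C) lshift"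
    and s: "s \<in> SFT C" and iso: "cyl C s N = {s}" and n: "n \<ge> 1" and per: "(lshift ^^ n) s = s"
  shows "finite (SFT C)"
proof -
  have per': "s (i + int n) = s i" for i
    using per unfolding lshift_funpow by metis
  have per_mult: "s (i + int (q * n)) = s i" for i q
  proof (induction q)
    case (Suc q)
    have "s (i + int (Suc q * n)) = s (i + int (q * n) + int n)" by (simp add: algebra_simps)
    then show ?case using Suc per' by simp
  qed simp
  \<comment> \<open>Negative \<open>k\<close> are included because transitivity may supply a
    negative time.\<close>
  have per_mod: "s (i + k mod int n) = s (i + k)" for i k
  proof (cases "k div int n \<ge> 0")
    case True
    have "i + k = i + k mod int n + int (nat (k div int n) * n)"
      using True by (simp add: algebra_simps)
    then show ?thesis using per_mult by metis
  next
    case False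
    have "i + k mod int n = i + k + int (nat (- (k div int n)) * n)"
      using False by (simp add: minus_div_mult_eq_mod[symmetric])
    then show ?thesis using per_mult by metis
  qed
  have "SFT C \<subseteq> (\<lambda>k i. s (i + k)) ` {0..<int n}"
  proof (rule ccontr)
    assume "\<not> ?thesis"
    then obtain t where t: "t \<in> SFT C" "t \<notin> (\<lambda>k i. s (i + k)) ` {0..<int n}" by blast
    have "\<exists>i. t i \<noteq> s (i + k)" if "k \<in> {0..<int n}" for k
    proof (rule ccontr)
      assume "\<nexists>i. t i \<noteq> s (i + k)"
      then have "t = (\<lambda>i. s (i + k))" by blast
      then have "t \<in> (\<lambda>k i. s (i + k)) ` {0..<int n}" using that by (rule image_eqI)
      then show False using t(2) by contradiction
    qed
    then have "\<forall>k. \<exists>i. k \<in> {0..<int n} \<longrightarrow> t i \<noteq> s (i + k)" by blast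
    from choice[OF this] obtain j where
      "\<forall>k. k \<in> {0..<int n} \<longrightarrow> t (j k) \<noteq> s (j k + k)" ..
    then have j: "t (j k) \<noteq> s (j k + k)" if "k \<in> {0..<int n}" for k using that by simp
    \<comment> \<open>\<open>M\<close> is chosen so that the window around \<open>t\<close>
      contains, for each of the \<open>n\<close> translates of \<open>s\<close>, a coordinate where
      \<open>t\<close> differs from it.\<close>
    have "finite ((\<lambda>k. nat \<bar>j k\<bar>) ` {0..<int n})" by simp
    then obtain M where M: "\<And>k. k \<in> {0..<int n} \<Longrightarrow> nat \<bar>j k\<bar> \<le> M"
      unfolding finite_nat_set_iff_bounded_le by blast
    have "openin (SFT_top C) {s}" using openin_cyl[of C s N] iso by simp
    moreover have "cyl C t M \<noteq> {}" using self_in_cyl[OF t(1)] by blast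
    ultimately obtain l where "(lshift ^^ l) ` {s} \<inter> cyl C t M \<noteq> {} \<or> {s} \<inter> (lshift ^^ l) ` cyl C t M \<noteq> {}"
      using trans[unfolded dyn_transitive_def, rule_format, of "{s}" "cyl C t M"] openin_cyl[of C t M]
      by blast
    then have "\<exists>k. \<forall>i. \<bar>i\<bar> \<le> int M \<longrightarrow> t i = s (i + k)"
    proof
      assume "(lshift ^^ l) ` {s} \<inter> cyl C t M \<noteq> {}"
      then show ?thesis unfolding lshift_funpow cyl_def by (intro exI[of _ "int l"]) auto
    next
      assume "{s} \<inter> (lshift ^^ l) ` cyl C t M \<noteq> {}"
      then obtain u where u: "u \<in> cyl C t M" "(lshift ^^ l) u = s" by auto
      have "u i = s (i + - int l)" for i using lshift_funpow_eqD[OF u(2)] by simp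
      then show ?thesis using u(1) unfolding cyl_def by (intro exI[of _ "- int l"]) auto
    qed
    then obtain k where k: "\<And>i. \<bar>i\<bar> \<le> int M \<Longrightarrow> t i = s (i + k)" by blast
    have kn: "k mod int n \<in> {0..<int n}" using n by simp
    have "t (j (k mod int n)) = s (j (k mod int n) + k)" using k M[OF kn] by simp
    then show False using j[OF kn] per_mod by simp
  qed
  then show ?thesis by (rule finite_subset) simp
qed

text \<open>Over an isolated \<open>s\<close>, the points in the fibres of the classes of
  \<open>0\<close> and \<open>1\<close> modulo 2 are isolated too. A passage between them takes a
  nonzero time, as the classes differ, so \<open>s\<close> is periodic and the base would be
  finite.\<close>

lemma perfect_SFT_if_ftp:
  fixes h :: "'s \<Rightarrow> 's \<Rightarrow> int ^ 'd"
  assumes trans: "dyn_transitive (SFT_top C) lshift" and inf: "infinite (SFT C)" and "ftp C h"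
  shows "perfect_SFT C"
  unfolding perfect_SFT_def
proof (intro ballI allI notI)
  fix s N assume s: "s \<in> SFT C" and iso: "cyl C s N = {s}"
  let ?G = "int_multiples 2 :: (int ^ 'd) set"
  let ?c = "\<lambda>x. (\<lambda>g. x + g) ` ?G"
  have G0: "0 \<in> ?G" using finite_index_int_multiples[of 2] unfolding finite_index_subgroup_def by auto
  have ne: "?c 0 \<noteq> ?c 1"
  proof
    assume "?c 0 = ?c 1"
    from coset_eqD[OF this G0] obtain z :: "int ^ 'd" where "1 = 2 *s z"
      unfolding int_multiples_def by auto
    \<comment> \<open>\<open>1\<close> is the vector with all entries 1 and \<open>undefined\<close>
      stands for an arbitrary coordinate; parity gives the contradiction.\<close>
    then have "1 = 2 * z $ undefined" by (metis one_index vector_smult_component)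
    then show False by presburger
  qed
  let ?T = "prod_topology (SFT_top C) (discrete_topology (cosets ?G))"
  have "openin ?T ({s} \<times> {?c x})" for x
    using openin_cyl_prod[of "?c x" "cosets ?G" C s N] iso by (auto simp: cosets_def)
  moreover have "{s} \<times> {?c x} \<noteq> {}" for x by simp
  ultimately obtain n where n: "(skew_quot h ?G ^^ n) ` ({s} \<times> {?c 0}) \<inter> ({s} \<times> {?c 1}) \<noteq> {} \<or>
      ({s} \<times> {?c 0}) \<inter> (skew_quot h ?G ^^ n) ` ({s} \<times> {?c 1}) \<noteq> {}"
    using ftpD[OF \<open>ftp C h\<close>, of 2, unfolded dyn_transitive_def, rule_format,
        of "{s} \<times> {?c 0}" "{s} \<times> {?c 1}"] by fastforce
  then have "(skew_quot h ?G ^^ n) (s, ?c 0) = (s, ?c 1) \<or> (s, ?c 0) = (skew_quot h ?G ^^ n) (s, ?c 1)"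
    by blast
  then have "(lshift ^^ n) s = s" unfolding skew_quot_funpow prod.inject by metis
  moreover have "n \<noteq> 0"
  proof
    assume "n = 0"
    have "?c 0 = ?c 1" using n unfolding \<open>n = 0\<close> funpow.simps(1) image_id id_apply by blast
    with ne show False by contradiction
  qed
  ultimately show False
    using finite_SFT_if_periodic_isolated[OF trans s iso, of n] inf by simp
qed

section \<open>Weighted paths in the transition graph\<close>

text \<open>A path of length \<open>n\<close> and weight \<open>v\<close> is carried by a
  bi-infinite sequence so that \<open>hsum\<close> applies to it directly; the coordinates outside
  \<open>0\<close> to \<open>n\<close> are arbitrary.\<close>

definition wpath :: "('s \<Rightarrow> 's \<Rightarrow> bool) \<Rightarrow> ('s \<Rightarrow> 's \<Rightarrow> int ^ 'd) \<Rightarrow> nat \<Rightarrow> int ^ 'd \<Rightarrow> 's \<Rightarrow> 's \<Rightarrow> bool"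
  where "wpath C h n v a b \<longleftrightarrow> (\<exists>s :: int \<Rightarrow> 's. s 0 = a \<and> s (int n) = b \<and>
    (\<forall>i. 0 \<le> i \<and> i < int n \<longrightarrow> C (s i) (s (i + 1))) \<and> hsum h s n = v)"

lemma wpath_refl: "wpath C h 0 0 a a"
  unfolding wpath_def by (intro exI[of _ "\<lambda>_. a"]) auto

lemma wpath_trans:
  assumes "wpath C h m v a b" "wpath C h n w b c"
  shows "wpath C h (m + n) (v + w) a c"
proof -
  obtain s where s: "s 0 = a" "s (int m) = b" "\<And>i. 0 \<le> i \<Longrightarrow> i < int m \<Longrightarrow> C (s i) (s (i + 1))"
    "hsum h s m = v" using assms(1) unfolding wpath_def by blast
  obtain t where t: "t 0 = b" "t (int n) = c" "\<And>i. 0 \<le> i \<Longrightarrow> i < int n \<Longrightarrow> C (t i) (t (i + 1))"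
    "hsum h t n = w" using assms(2) unfolding wpath_def by blast
  define u where "u i = (if i \<le> int m then s i else t (i - int m))" for i
  have u1: "u i = s i" if "i \<le> int m" for i using that by (simp add: u_def)
  have u2: "u i = t (i - int m)" if "i \<ge> int m" for i using that s(2) t(1) by (auto simp: u_def)
  have "hsum h u m = v" using hsum_cong[of m u s h] u1 s(4) by simp
  moreover have "hsum h (\<lambda>i. u (i + int m)) n = w"
    using hsum_cong[of n "\<lambda>i. u (i + int m)" t h] u2 t(4) by simp
  ultimately have "hsum h u (m + n) = v + w" by (simp add: hsum_add)
  moreover have "C (u i) (u (i + 1))" if "0 \<le> i" "i < int (m + n)" for i
  proof (cases "i < int m")
    case True
    then show ?thesis using u1[of i] u1[of "i + 1"] s(3)[of i] that by simp
  next
    case False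
    then show ?thesis using u2[of i] u2[of "i + 1"] t(3)[of "i - int m"] that
      by (simp add: algebra_simps)
  qed
  moreover have "u 0 = a" "u (int (m + n)) = c" using u1[of 0] s(1) u2[of "int (m + n)"] t(2) by simp_all
  ultimately show ?thesis unfolding wpath_def by blast
qed

lemma wpath_SFT: "s \<in> SFT C \<Longrightarrow> wpath C h n (hsum h (\<lambda>i. s (i + k)) n) (s k) (s (k + int n))"
  using shift_in_SFT[of s C k] unfolding wpath_def
  by (intro exI[of _ "\<lambda>i. s (i + k)"]) (auto simp: SFT_def add_ac)

lemma wpath_power:
  assumes "wpath C h n v a a"
  shows "wpath C h (k * n) (int k *s v) a a"
proof (induction k)
  case 0
  then show ?case using wpath_refl[of C h a] by simp
next
  case (Suc k)
  have "int (Suc k) *s v = v + int k *s v" by (simp add: vec_eq_iff algebra_simps)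
  then show ?case using wpath_trans[OF assms Suc] by simp
qed

text \<open>An orbit of the quotient by \<open>int_multiples N\<close> that goes from the class of
  \<open>0\<close> over \<open>s\<close> to the class of \<open>v\<close> over \<open>t\<close> is
  such a path. With \<open>N = 1\<close> this is the irreducibility of the graph.\<close>

lemma wpath_if_ftp:
  assumes perfect: "perfect_SFT C" and "ftp C h" and s: "s \<in> SFT C" and t: "t \<in> SFT C"
    and N: "(N :: int) > 0"
  shows "\<exists>n\<ge>1. \<exists>w. wpath C h n w (s 0) (t 0) \<and> (\<exists>z. v = w + N *s z)"
proof -
  let ?G = "int_multiples N"
  let ?c = "\<lambda>x. (\<lambda>g. x + g) ` ?G"
  have c: "?c x \<in> cosets ?G" for x by (auto simp: cosets_def)
  have F: "skew_quot h ?G = (\<lambda>(s, c). (lshift s, (\<lambda>x y c. (\<lambda>z. z + h x y) ` c) (s 0) (s 1) c))"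
    by (auto simp: skew_quot_def fun_eq_iff)
  obtain n u where n: "n \<ge> 1" and u: "u \<in> cyl C s 0"
    and "(skew_quot h ?G ^^ n) (u, ?c 0) \<in> cyl C t 0 \<times> {?c v}"
    by (rule late_return_skew_like[OF F _ perfect ftpD[OF \<open>ftp C h\<close> N] s t c[of 0] c[of v]])
       (rule translate_coset)
  then have r: "(lshift ^^ n) u \<in> cyl C t 0" "?c (hsum h u n) = ?c v"
    unfolding skew_quot_funpow by simp_all
  have "0 \<in> ?G" using finite_index_int_multiples[OF N] unfolding finite_index_subgroup_def by auto
  from coset_eqD[OF r(2) this] have "\<exists>z. v = hsum h u n + N *s z" unfolding int_multiples_def by blast
  moreover have "u \<in> SFT C" "u 0 = s 0" "u (int n) = t 0"
    using u r(1) unfolding cyl_def lshift_funpow by simp_all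
  ultimately show ?thesis using n wpath_SFT[of u C h n 0] by auto
qed

lemma skew_late_return:
  assumes perfect: "perfect_SFT C" and trans: "dyn_transitive (skew_top C) (skew h)"
    and s: "s \<in> SFT C" and t: "t \<in> SFT C"
  obtains n u where "n \<ge> k" "u \<in> cyl C s N" "(\<lambda>i. u (i + int n)) \<in> cyl C t N" "x + hsum h u n = y"
proof -
  have F: "skew h = (\<lambda>(s, c). (lshift s, (\<lambda>x y c. c + h x y) (s 0) (s 1) c))"
    by (auto simp: skew_def fun_eq_iff)
  obtain n u where "n \<ge> k" "u \<in> cyl C s N" "(skew h ^^ n) (u, x) \<in> cyl C t N \<times> {y}"
    by (rule late_return_skew_like[OF F _ perfect trans[unfolded skew_top_def] s t, of x y k N]) auto
  then show ?thesis using that[of n u] unfolding skew_funpow lshift_funpow by simp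
qed

lemma wpath_if_transitive:
  assumes perfect: "perfect_SFT C" and trans: "dyn_transitive (skew_top C) (skew h)"
    and s: "s \<in> SFT C" and t: "t \<in> SFT C"
  shows "\<exists>n\<ge>1. wpath C h n v (s 0) (t 0)"
proof -
  obtain n u where "n \<ge> 1" "u \<in> cyl C s 0" "(\<lambda>i. u (i + int n)) \<in> cyl C t 0" "0 + hsum h u n = v"
    by (rule skew_late_return[OF assms])
  then show ?thesis using wpath_SFT[of u C h n 0] unfolding cyl_def by auto
qed

section \<open>Splicing orbits and periodic points\<close>

text \<open>Follow \<open>s\<close> up to coordinate \<open>M\<close>, then a connecting path, then
  \<open>t\<close> from coordinate \<open>- N\<close> on; the free choice of the path's weight
  adjusts the fibre coordinate.\<close>

lemma dyn_transitive_if_wpaths: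
  fixes h :: "'s \<Rightarrow> 's \<Rightarrow> int ^ 'd"
  assumes paths: "\<And>s t v. s \<in> SFT C \<Longrightarrow> t \<in> SFT C \<Longrightarrow> \<exists>n. wpath C h n v (s 0) (t 0)"
  shows "dyn_transitive (skew_top C) (skew h)"
  unfolding dyn_transitive_def
proof (intro allI impI, elim conjE)
  fix U V :: "((int \<Rightarrow> 's) \<times> (int ^ 'd)) set"
  assume U: "openin (skew_top C) U" "U \<noteq> {}" and V: "openin (skew_top C) V" "V \<noteq> {}"
  have in_cyl: "\<exists>s x N. s \<in> SFT C \<and> cyl C s N \<times> {x} \<subseteq> W" if W: "openin (skew_top C) W" "W \<noteq> {}"
    for W :: "((int \<Rightarrow> 's) \<times> (int ^ 'd)) set"
  proof -
    obtain s x where sx: "(s, x) \<in> W" using W(2) by (metis ex_in_conv surj_pair)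
    have W': "W \<subseteq> SFT C \<times> UNIV" "\<forall>s c. (s, c) \<in> W \<longrightarrow> (\<exists>N. cyl C s N \<times> {c} \<subseteq> W)"
      using W(1) unfolding skew_top_def openin_SFT_prod_iff by (rule conjunct1, rule conjunct2)
    from W'(2) sx obtain N where "cyl C s N \<times> {x} \<subseteq> W" by blast
    moreover have "s \<in> SFT C" using W'(1) sx by blast
    ultimately show ?thesis by blast
  qed
  obtain s x M where s: "s \<in> SFT C" "cyl C s M \<times> {x} \<subseteq> U" using in_cyl[OF U] by blast
  obtain t y N where t: "t \<in> SFT C" "cyl C t N \<times> {y} \<subseteq> V" using in_cyl[OF V] by blast
  \<comment> \<open>What remains of \<open>y - x\<close> after the weights of \<open>s\<close> on
    \<open>0\<close> to \<open>M\<close> and of \<open>t\<close> on \<open>- N\<close> to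
    \<open>0\<close>.\<close>
  define v where "v = y - x - hsum h s M - hsum h (\<lambda>i. t (i + - int N)) N"
  obtain n where "wpath C h n v (s (0 + int M)) (t (0 + - int N))"
    using paths[OF shift_in_SFT[OF s(1), of "int M"] shift_in_SFT[OF t(1), of "- int N"]] by blast
  then obtain g :: "int \<Rightarrow> 's" where g: "g 0 = s (int M)" "g (int n) = t (- int N)"
    "\<And>i. 0 \<le> i \<Longrightarrow> i < int n \<Longrightarrow> C (g i) (g (i + 1))" "hsum h g n = v"
    unfolding wpath_def by auto
  define u where "u i = (if i \<le> int M then s i else if i \<le> int M + int n then g (i - int M)
    else t (i - (int M + int n + int N)))" for i
  have u1: "u i = s i" if "i \<le> int M" for i using that by (simp add: u_def)
  have u2: "u i = g (i - int M)" if "int M \<le> i" "i \<le> int M + int n" for i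
    using that g(1) by (auto simp: u_def)
  have u3: "u i = t (i - (int M + int n + int N))" if "int M + int n \<le> i" for i
  proof (cases "i = int M + int n")
    case True
    then show ?thesis using u2[of i] g(2) by simp
  next
    case False
    then show ?thesis using that by (simp add: u_def)
  qed
  have sC: "C (s i) (s (i + 1))" and tC: "C (t i) (t (i + 1))" for i
    using s(1) t(1) unfolding SFT_def by auto
  have uC: "C (u i) (u (i + 1))" for i
  proof -
    consider "i < int M" | "int M \<le> i" "i < int M + int n" | "int M + int n \<le> i" by linarith
    then show ?thesis
    proof cases
      case 1
      then show ?thesis using u1[of i] u1[of "i + 1"] sC by simp
    next
      case 2
      then show ?thesis using u2[of i] u2[of "i + 1"] g(3)[of "i - int M"] by (simp add: algebra_simps)
    next
      case 3
      then show ?thesis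
        using u3[of i] u3[of "i + 1"] tC[of "i - (int M + int n + int N)"] by (simp add: algebra_simps)
    qed
  qed
  then have uS: "u \<in> SFT C" unfolding SFT_def by blast
  \<comment> \<open>\<open>M\<close> steps leave the window of \<open>s\<close>, \<open>n\<close>
    steps follow the path, and \<open>N\<close> more bring the origin of \<open>t\<close> to
    coordinate 0.\<close>
  let ?p = "M + n + N"
  have a: "u \<in> cyl C s M" using uS u1 unfolding cyl_def by auto
  have "(\<lambda>i. u (i + int ?p)) \<in> SFT C" by (rule shift_in_SFT[OF uS])
  moreover have "u (i + int ?p) = t i" if "\<bar>i\<bar> \<le> int N" for i
    using u3[of "i + int ?p"] that by simp
  ultimately have b: "(\<lambda>i. u (i + int ?p)) \<in> cyl C t N" unfolding cyl_def by blast
  have "hsum h u M = hsum h s M" using u1 by (intro hsum_cong) simp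
  moreover have "hsum h (\<lambda>i. u (i + int M)) n = v"
    using hsum_cong[of n "\<lambda>i. u (i + int M)" g h] u2 g(4) by simp
  moreover have "hsum h (\<lambda>i. u (i + int (M + n))) N = hsum h (\<lambda>i. t (i + - int N)) N"
    using u3 by (intro hsum_cong) simp
  ultimately have "x + hsum h u ?p = y" by (simp add: hsum_add v_def)
  then have "(skew h ^^ ?p) (u, x) \<in> V"
    using b t(2) unfolding skew_funpow lshift_funpow by blast
  moreover have "(u, x) \<in> U" using a s(2) by blast
  ultimately show "\<exists>n. (skew h ^^ n) ` U \<inter> V \<noteq> {} \<or> U \<inter> (skew h ^^ n) ` V \<noteq> {}" by blast
qed

text \<open>All loops share the base state \<open>a\<close> and the length \<open>L\<close>, so
  division with remainder by \<open>L\<close> finds the block of a coordinate and its place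
  there.\<close>

lemma concat_loops:
  fixes G :: "int \<Rightarrow> int \<Rightarrow> 's"
  assumes L: "L \<ge> 1" and G0: "\<And>k. G k 0 = a" and GL: "\<And>k. G k (int L) = a"
    and GC: "\<And>k i. 0 \<le> i \<Longrightarrow> i < int L \<Longrightarrow> C (G k i) (G k (i + 1))"
  shows "\<exists>s\<in>SFT C. (\<forall>k i. 0 \<le> i \<longrightarrow> i \<le> int L \<longrightarrow> s (k * int L + i) = G k i) \<and>
    (\<forall>k. hsum h s (k * L) = (\<Sum>j<k. hsum h (G (int j)) L))"
proof -
  define s where "s i = G (i div int L) (i mod int L)" for i
  have s: "s (k * int L + i) = G k i" if i: "0 \<le> i" "i \<le> int L" for k i
  \<comment> \<open>At a seam the coordinate already belongs to the next block, but both blocks have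
    the state \<open>a\<close> there.\<close>
  proof (cases "i = int L")
    case True
    have "k * int L + i = (k + 1) * int L" using True by (simp add: algebra_simps)
    then show ?thesis using L G0 GL True by (simp add: s_def)
  next
    case False
    then show ?thesis using i by (simp add: s_def div_pos_pos_trivial mod_pos_pos_trivial)
  qed
  have "C (s i) (s (i + 1))" for i
  proof -
    have m: "0 \<le> i mod int L" "i mod int L < int L" using L by simp_all
    have "s (i div int L * int L + i mod int L) = G (i div int L) (i mod int L)"
      "s (i div int L * int L + (i mod int L + 1)) = G (i div int L) (i mod int L + 1)"
      using m by (intro s; simp)+
    moreover have "i div int L * int L + (i mod int L + 1) = i + 1"
      by (metis add.assoc div_mult_mod_eq)
    ultimately show ?thesis using GC[OF m] by simp
  qed
  then have "s \<in> SFT C" unfolding SFT_def by blast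
  moreover have "hsum h s (k * L) = (\<Sum>j<k. hsum h (G (int j)) L)" for k
  proof (induction k)
    case (Suc k)
    have "hsum h (\<lambda>i. s (i + int (k * L))) L = hsum h (G (int k)) L"
    proof (rule hsum_cong)
      fix i assume "0 \<le> i" "i \<le> int L"
      from s[OF this, of "int k"] show "s (i + int (k * L)) = G (int k) i" by (simp add: add.commute)
    qed
    moreover have "hsum h s (Suc k * L) = hsum h s (k * L + L)" by (simp add: add.commute)
    ultimately show ?case using Suc by (simp only: hsum_add sum.lessThan_Suc)
  qed simp
  ultimately show ?thesis using s by blast
qed

section \<open>Periodic points\<close>

lemma periodic_extension:
  assumes n: "n \<ge> 1" and g0: "g 0 = g (int n)"
    and gC: "\<And>i. 0 \<le> i \<Longrightarrow> i < int n \<Longrightarrow> C (g i) (g (i + 1))"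
  shows "\<exists>s\<in>SFT C. (\<forall>k i. 0 \<le> i \<longrightarrow> i \<le> int n \<longrightarrow> s (k * int n + i) = g i) \<and>
    (\<forall>k. hsum h s (k * n) = (\<Sum>j<k. hsum h g n))"
  by (rule concat_loops[of n "\<lambda>_. g" "g 0"]) (use assms in simp_all)

lemma periodic_pts_iff:
  "(s, x) \<in> periodic_pts C h \<longleftrightarrow>
     s \<in> SFT C \<and> (\<exists>p\<ge>1. (\<forall>i. s (i + int p) = s i) \<and> hsum h s p = 0)"
  unfolding periodic_pts_def by (auto simp: skew_funpow lshift_funpow fun_eq_iff)

text \<open>Whether \<open>(u, x)\<close> is periodic does not depend on \<open>x\<close>, so it is
  enough to look for periodic points at height 0 in cylinders of the base.\<close>

lemma dense_periodic_iff:
  fixes h :: "'s \<Rightarrow> 's \<Rightarrow> int ^ 'd"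
  shows "(skew_top C) closure_of (periodic_pts C h) = topspace (skew_top C) \<longleftrightarrow>
     (\<forall>s\<in>SFT C. \<forall>N. \<exists>u\<in>cyl C s N. (u, 0) \<in> periodic_pts C h)"
proof -
  have indep: "(u, x) \<in> periodic_pts C h \<longleftrightarrow> (u, 0) \<in> periodic_pts C h" for u x
    unfolding periodic_pts_iff ..
  have "(skew_top C) closure_of (periodic_pts C h) = topspace (skew_top C) \<longleftrightarrow>
     (\<forall>W. openin (skew_top C) W \<and> W \<noteq> {} \<longrightarrow> periodic_pts C h \<inter> W \<noteq> {})"
    by (rule dense_intersects_open)
  also have "\<dots> \<longleftrightarrow> (\<forall>s\<in>SFT C. \<forall>N. \<exists>u\<in>cyl C s N. (u, 0) \<in> periodic_pts C h)"
  proof (intro iffI ballI allI impI)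
    fix s N assume *: "\<forall>W. openin (skew_top C) W \<and> W \<noteq> {} \<longrightarrow> periodic_pts C h \<inter> W \<noteq> {}"
      and s: "s \<in> SFT C"
    have "openin (skew_top C) (cyl C s N \<times> {0})" unfolding skew_top_def by (rule openin_cyl_prod) simp
    moreover have "cyl C s N \<times> {0} \<noteq> {}" using self_in_cyl[OF s] by blast
    ultimately have "periodic_pts C h \<inter> (cyl C s N \<times> {0}) \<noteq> {}" using * by blast
    then show "\<exists>u\<in>cyl C s N. (u, 0) \<in> periodic_pts C h" by blast
  next
    fix W :: "((int \<Rightarrow> 's) \<times> (int ^ 'd)) set"
    assume *: "\<forall>s\<in>SFT C. \<forall>N. \<exists>u\<in>cyl C s N. (u, 0) \<in> periodic_pts C h"
      and W: "openin (skew_top C) W \<and> W \<noteq> {}"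
    then obtain s x where sx: "(s, x) \<in> W" by (metis ex_in_conv surj_pair)
    have W': "W \<subseteq> SFT C \<times> UNIV" "\<forall>s c. (s, c) \<in> W \<longrightarrow> (\<exists>N. cyl C s N \<times> {c} \<subseteq> W)"
      using W[THEN conjunct1] unfolding skew_top_def openin_SFT_prod_iff by (rule conjunct1, rule conjunct2)
    from W'(2) sx obtain N where N: "cyl C s N \<times> {x} \<subseteq> W" by blast
    have "s \<in> SFT C" using W'(1) sx by blast
    with * obtain u where "u \<in> cyl C s N" "(u, 0) \<in> periodic_pts C h" by blast
    then show "periodic_pts C h \<inter> W \<noteq> {}" using N indep[of u x] by blast
  qed
  finally show ?thesis .
qed

text \<open>Repeat the loop periodically and approximate the result by a periodic point
  \<open>u\<close> of the skew product that runs through the loop once. The weight over a full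
  period is 0, so the rest of the period is a loop of weight \<open>- m\<close>.\<close>

lemma opposite_loop_if_dense_periodic:
  assumes dense: "\<And>s N. s \<in> SFT C \<Longrightarrow> \<exists>u\<in>cyl C s N. (u, 0) \<in> periodic_pts C h"
    and loop: "wpath C h n m a a" and n: "n \<ge> 1"
  shows "\<exists>n'. wpath C h n' (- m) a a"
proof -
  obtain g where g: "g 0 = a" "g (int n) = a" "\<And>i. 0 \<le> i \<Longrightarrow> i < int n \<Longrightarrow> C (g i) (g (i + 1))"
    "hsum h g n = m" using loop unfolding wpath_def by blast
  obtain s where s: "s \<in> SFT C"
    "\<And>k i. 0 \<le> i \<Longrightarrow> i \<le> int n \<Longrightarrow> s (k * int n + i) = g i"
    "\<And>k. hsum h s (k * n) = (\<Sum>j<k. hsum h g n)"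
    using periodic_extension[of n g C h] n g(1-3) by auto
  obtain u where u: "u \<in> cyl C s n" "(u, 0) \<in> periodic_pts C h" using dense[OF s(1)] by blast
  then obtain p where p: "p \<ge> 1" "\<And>i. u (i + int p) = u i" "hsum h u p = 0" and uS: "u \<in> SFT C"
    unfolding periodic_pts_iff by blast
  have per: "u (i + int (k * p)) = u i \<and> hsum h u (k * p) = 0" for k i
  proof (induction k arbitrary: i)
    case (Suc k)
    have "hsum h u (k * p + p) = 0" using Suc p(3) by (simp add: hsum_add)
    moreover have "u (i + int (Suc k * p)) = u (i + int (k * p) + int p)"
      by (rule arg_cong[where f = u]) (simp add: algebra_simps)
    then have "u (i + int (Suc k * p)) = u i" using Suc[of i] p(2)[of "i + int (k * p)"] by (simp only:)
    ultimately show ?case by (simp only: mult_Suc add.commute)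
  qed simp
  \<comment> \<open>A multiple of the period that is at least \<open>n\<close>, so that the whole
    loop fits into it.\<close>
  let ?q = "(n + 1) * p"
  have le: "n \<le> ?q" using p(1) by (cases p) auto
  have ug: "u i = g i" if "0 \<le> i" "i \<le> int n" for i
    using u(1) s(2)[OF that, of 0] that unfolding cyl_def by simp
  have "wpath C h (?q - n) (hsum h (\<lambda>i. u (i + int n)) (?q - n)) (u (int n)) (u (int n + int (?q - n)))"
    by (rule wpath_SFT[OF uS])
  moreover have "u (int n + int (?q - n)) = a"
    using per[of 0 "n + 1"] le ug[of 0] g(1) by simp
  moreover have "u (int n) = a" using ug g(2) by simp
  moreover have "hsum h u (n + (?q - n)) = hsum h u n + hsum h (\<lambda>i. u (i + int n)) (?q - n)"
    by (rule hsum_add)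
  moreover have "hsum h u n = m" using hsum_cong[of n u g h] ug g(4) by simp
  moreover have "hsum h u (n + (?q - n)) = 0" using per[of 0 "n + 1"] le by simp
  ultimately show ?thesis by (metis add.inverse_unique)
qed

text \<open>A return of the cylinder to itself with weight 0 is closed up periodically. Coordinates
  of \<open>u\<close> from 0 on come from the start of the segment and negative ones from its end;
  \<open>n \<ge> N + 1\<close> keeps both within one period.\<close>

lemma dense_periodic_if_transitive:
  assumes perfect: "perfect_SFT C" and trans: "dyn_transitive (skew_top C) (skew h)"
    and s: "s \<in> SFT C"
  shows "\<exists>u\<in>cyl C s N. (u, 0) \<in> periodic_pts C h"
proof -
  obtain n w where n: "n \<ge> N + 1" and w: "w \<in> cyl C s N" "(\<lambda>i. w (i + int n)) \<in> cyl C s N"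
    "0 + hsum h w n = 0"
    by (rule skew_late_return[OF perfect trans s s])
  have wC: "C (w i) (w (i + 1))" for i using w(1) unfolding cyl_def SFT_def by blast
  have w1: "w i = s i" if "\<bar>i\<bar> \<le> int N" for i using w(1) that unfolding cyl_def by blast
  have w2: "w (i + int n) = s i" if "\<bar>i\<bar> \<le> int N" for i using w(2) that unfolding cyl_def by blast
  have ends: "w 0 = s 0" "w (int n) = s 0" using w1[of 0] w2[of 0] by simp_all
  have "n \<ge> 1" using n by simp
  then obtain u where u: "u \<in> SFT C"
    "\<And>k i. 0 \<le> i \<Longrightarrow> i \<le> int n \<Longrightarrow> u (k * int n + i) = w i"
    "\<And>k. hsum h u (k * n) = (\<Sum>j<k. hsum h w n)"
    using periodic_extension[of n w C h] ends wC by auto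
  have "u (i + int n) = u i" for i
  proof -
    have m: "0 \<le> i mod int n" "i mod int n \<le> int n" using n by (simp_all add: order_less_imp_le)
    have "u (i div int n * int n + i mod int n) = w (i mod int n)"
      "u ((i div int n + 1) * int n + i mod int n) = w (i mod int n)"
      using u(2)[OF m] by blast+
    moreover have "(i div int n + 1) * int n + i mod int n = i + int n"
      by (simp add: distrib_right)
    ultimately show ?thesis by simp
  qed
  moreover have "hsum h u n = 0" using u(3)[of 1] w(3) by simp
  ultimately have "(u, 0) \<in> periodic_pts C h"
    unfolding periodic_pts_iff using u(1) n by (intro conjI exI[of _ n]) auto
  moreover have "u i = s i" if i: "\<bar>i\<bar> \<le> int N" for i
  proof (cases "i \<ge> 0")
    case True
    then show ?thesis using u(2)[of i 0] w1[OF i] i n by simp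
  next
    case False
    then show ?thesis using u(2)[of "i + int n" "-1"] w2[OF i] i n by simp
  qed
  ultimately show ?thesis using u(1) unfolding cyl_def by blast
qed

section \<open>Rotation vectors\<close>

text \<open>For large \<open>q\<close> the vector \<open>- m / q\<close> is a rotation vector, so a
  piece of length \<open>q * k\<close> of its orbit has weight \<open>- k m\<close> up to an error
  that is small compared with \<open>k\<close>. Closing the piece to a loop changes the weight by a
  bounded amount.\<close>

lemma opposite_loop_if_interior_rot:
  fixes h :: "'s::finite \<Rightarrow> 's \<Rightarrow> int ^ 'd"
  assumes int: "0 \<in> interior (rot_set C h)"
    and conn: "\<And>s t. s \<in> SFT C \<Longrightarrow> t \<in> SFT C \<Longrightarrow> \<exists>n w. wpath C h n w (s 0) (t 0)"
    and s0: "s0 \<in> SFT C"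
  shows "\<exists>k n m'. wpath C h n m' (s0 0) (s0 0) \<and> (\<forall>j. \<bar>(m' + int k *s m) $ j\<bar> < int k)"
proof -
  obtain e where e: "e > 0" "ball 0 e \<subseteq> rot_set C h"
    using int by (meson mem_interior)
  \<comment> \<open>The bound puts \<open>- m / q\<close> into the ball of radius \<open>e\<close>;
    the extra 1 keeps \<open>q\<close> positive.\<close>
  obtain q :: nat where q: "real q > norm (real_vec m) / e + 1"
    using reals_Archimedean2 by blast
  have "norm (real_vec m) / e \<ge> 0" using e(1) by simp
  then have q0: "q > 0" using q by linarith
  have "norm (real_vec m) < e * real q" using q e(1) by (simp add: field_simps)
  then have "norm (- (1 / real q) *\<^sub>R real_vec m) < e" using q0 by (simp add: field_simps)
  then have "- (1 / real q) *\<^sub>R real_vec m \<in> rot_set C h" using e(2) by auto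
  then obtain s where s: "s \<in> SFT C"
    and lim: "(\<lambda>n. (1 / real n) *\<^sub>R real_vec (hsum h s n)) \<longlonglongrightarrow> - (1 / real q) *\<^sub>R real_vec m"
    unfolding rot_set_def by blast
  obtain n0 \<alpha> where \<alpha>: "wpath C h n0 \<alpha> (s0 0) (s 0)" using conn[OF s0 s] by blast
  have "\<exists>n w. wpath C h n w (s (int k)) (s0 0)" for k
    using conn[OF shift_in_SFT[OF s, of "int k"] s0] by simp
  \<comment> \<open>The closing weight is chosen by the state and not by the time, so it takes
    finitely many values and the bound \<open>B\<close> below does not depend on
    \<open>k\<close>.\<close>
  then have "\<forall>b. \<exists>w. b \<in> range (\<lambda>k. s (int k)) \<longrightarrow> (\<exists>n. wpath C h n w b (s0 0))" by blast
  from choice[OF this] obtain \<beta> where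
    "\<forall>b. b \<in> range (\<lambda>k. s (int k)) \<longrightarrow> (\<exists>n. wpath C h n (\<beta> b) b (s0 0))" ..
  then have \<beta>: "\<exists>n. wpath C h n (\<beta> (s (int k))) (s (int k)) (s0 0)" for k by blast
  define B where "B = (\<Sum>b\<in>UNIV. \<Sum>j\<in>UNIV. \<bar>(\<alpha> + \<beta> b) $ j\<bar>)"
  have B: "\<bar>(\<alpha> + \<beta> b) $ j\<bar> \<le> B" for b j
  proof -
    have "\<bar>(\<alpha> + \<beta> b) $ j\<bar> \<le> (\<Sum>j\<in>UNIV. \<bar>(\<alpha> + \<beta> b) $ j\<bar>)" by (rule member_le_sum) auto
    also have "\<dots> \<le> B" unfolding B_def
      by (rule member_le_sum[of b UNIV "\<lambda>b. \<Sum>j\<in>UNIV. \<bar>(\<alpha> + \<beta> b) $ j\<bar>"]) (auto intro: sum_nonneg)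
    finally show ?thesis .
  qed
  have "eventually (\<lambda>n. dist ((1 / real n) *\<^sub>R real_vec (hsum h s n)) (- (1 / real q) *\<^sub>R real_vec m) < 1 / (2 * real q)) sequentially"
    using lim q0 by (intro tendstoD) auto
  then obtain n1 where n1: "\<And>n. n \<ge> n1 \<Longrightarrow>
      dist ((1 / real n) *\<^sub>R real_vec (hsum h s n)) (- (1 / real q) *\<^sub>R real_vec m) < 1 / (2 * real q)"
    unfolding eventually_sequentially by blast
  \<comment> \<open>The accuracy \<open>1 / (2 * real q)\<close> over length \<open>q * k\<close>
    costs less than \<open>k / 2\<close>, and \<open>2 * B < k\<close> leaves the other half for the
    connecting paths.\<close>
  define k where "k = n1 + nat (2 * B) + 1"
  have k0: "k > 0" "2 * B < int k" and "n1 \<le> k" unfolding k_def by auto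
  then have "n1 \<le> q * k" using mult_le_mono[of 1 q n1 k] q0 by simp
  define H where "H = hsum h s (q * k)"
  have Hj: "2 * \<bar>(H + int k *s m) $ j\<bar> < int k" for j
  proof -
    have qk: "real (q * k) > 0" using q0 k0 by simp
    let ?d = "(1 / real (q * k)) *\<^sub>R real_vec H - (- (1 / real q) *\<^sub>R real_vec m)"
    have "norm ?d < 1 / (2 * real q)"
      using n1[OF \<open>n1 \<le> q * k\<close>] unfolding H_def dist_norm .
    then have "\<bar>?d $ j\<bar> < 1 / (2 * real q)"
      using component_le_norm_cart[of ?d j] by linarith
    moreover have "?d $ j = real_of_int ((H + int k *s m) $ j) / real (q * k)"
      using q0 k0 by (simp add: real_vec_def field_simps)
    ultimately have "\<bar>real_of_int ((H + int k *s m) $ j)\<bar> < real (q * k) * (1 / (2 * real q))"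
      using qk by (simp add: field_simps)
    also have "\<dots> = real k / 2" using q0 by simp
    finally have "real_of_int (2 * \<bar>(H + int k *s m) $ j\<bar>) < real_of_int (int k)" by simp
    then show ?thesis by (simp only: of_int_less_iff)
  qed
  have p1: "wpath C h (q * k) H (s 0) (s (int (q * k)))"
    using wpath_SFT[OF s, of h "q * k" 0] by (simp add: H_def)
  obtain n2 where "wpath C h n2 (\<beta> (s (int (q * k)))) (s (int (q * k))) (s0 0)" using \<beta> by blast
  from wpath_trans[OF wpath_trans[OF \<alpha> p1] this]
  have "wpath C h (n0 + q * k + n2) (\<alpha> + H + \<beta> (s (int (q * k)))) (s0 0) (s0 0)" .
  moreover have "\<bar>(\<alpha> + H + \<beta> (s (int (q * k))) + int k *s m) $ j\<bar> < int k" for j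
  proof -
    have "\<alpha> + H + \<beta> (s (int (q * k))) + int k *s m = (\<alpha> + \<beta> (s (int (q * k)))) + (H + int k *s m)"
      by (simp only: add_ac)
    moreover have "\<bar>x + y\<bar> < int k" if "\<bar>x\<bar> \<le> B" "2 * \<bar>y\<bar> < int k" for x y
      using that k0(2) by linarith
    ultimately show ?thesis using B Hj by (simp only: vector_add_component)
  qed
  ultimately show ?thesis by blast
qed

section \<open>From nearly opposite loops to transitivity\<close>

text \<open>Applies \<open>submonoid_eq_UNIV\<close> to the monoid of loop weights at
  \<open>s0 0\<close>; the ftp supplies its density hypothesis.\<close>

lemma UNIV_loops:
  fixes h :: "'s::finite \<Rightarrow> 's \<Rightarrow> int ^ 'd"
  assumes perfect: "perfect_SFT C" and ftp: "ftp C h" and s0: "s0 \<in> SFT C"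
    and opposite: "\<And>n m. n \<ge> 1 \<Longrightarrow> wpath C h n m (s0 0) (s0 0) \<Longrightarrow>
      \<exists>k n m'. wpath C h n m' (s0 0) (s0 0) \<and> (\<forall>j. \<bar>(m' + int k *s m) $ j\<bar> < int k)"
  shows "\<exists>n. wpath C h n v (s0 0) (s0 0)"
proof -
  define M where "M = {m. \<exists>n. wpath C h n m (s0 0) (s0 0)}"
  have "M = UNIV"
  proof (rule submonoid_eq_UNIV)
    show "0 \<in> M" unfolding M_def using wpath_refl[of C h "s0 0"] by blast
    show "x + y \<in> M" if "x \<in> M" "y \<in> M" for x y
      using that unfolding M_def by (blast intro: wpath_trans)
    show "\<exists>m\<in>M. \<exists>z. v = m + N *s z" if "N > 0" for N v
      using wpath_if_ftp[OF perfect ftp s0 s0 that, of v] unfolding M_def by blast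
    show "\<exists>k. \<exists>m'\<in>M. \<forall>j. \<bar>(m' + int k *s m) $ j\<bar> < int k" if m: "m \<in> M" for m
    proof -
      obtain n where n: "wpath C h n m (s0 0) (s0 0)" using m unfolding M_def by blast
      show ?thesis
      \<comment> \<open>The empty loop is not covered by \<open>opposite\<close>, but it has weight
        0 and is its own opposite.\<close>
      proof (cases "n = 0")
        case True
        then have "m = 0" using n unfolding wpath_def by auto
        then show ?thesis using \<open>0 \<in> M\<close> by (intro exI[of _ 1] bexI[of _ 0]) auto
      next
        case False
        then show ?thesis using opposite[OF _ n] unfolding M_def by auto
      qed
    qed
  qed
  then show ?thesis unfolding M_def by blast
qed

text \<open>Any path from \<open>s 0\<close> to \<open>t 0\<close> gets the prescribed weight after
  a loop at \<open>s 0\<close> with the missing weight \<open>v - w\<close> is put in front of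
  it.\<close>

lemma transitive_if_opposite:
  fixes h :: "'s::finite \<Rightarrow> 's \<Rightarrow> int ^ 'd"
  assumes perfect: "perfect_SFT C" and ftp: "ftp C h"
    and opposite: "\<And>s n m. s \<in> SFT C \<Longrightarrow> n \<ge> 1 \<Longrightarrow> wpath C h n m (s 0) (s 0) \<Longrightarrow>
      \<exists>k n m'. wpath C h n m' (s 0) (s 0) \<and> (\<forall>j. \<bar>(m' + int k *s m) $ j\<bar> < int k)"
  shows "dyn_transitive (skew_top C) (skew h)"
proof (rule dyn_transitive_if_wpaths)
  fix s t v assume s: "s \<in> SFT C" and t: "t \<in> SFT C"
  obtain n w where w: "wpath C h n w (s 0) (t 0)"
    using wpath_if_ftp[OF perfect ftp s t zero_less_one] by blast
  have "\<exists>n. wpath C h n (v - w) (s 0) (s 0)"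
    by (rule UNIV_loops[OF perfect ftp s]) (rule opposite[OF s])
  then obtain n' where "wpath C h n' (v - w) (s 0) (s 0)" by blast
  from wpath_trans[OF this w] show "\<exists>n. wpath C h n v (s 0) (t 0)" by auto
qed

section \<open>From loops of all weights to an open set of rotation vectors\<close>

text \<open>Lengths are equalised by padding with a loop of weight 0 and length
  \<open>\<nu> 0\<close>. Repeating the loop of weight \<open>v\<close> exactly
  \<open>\<nu> 0\<close> times makes its length a multiple of \<open>\<nu> 0\<close>, whence
  \<open>c = \<nu> 0\<close> and \<open>L = \<nu> 0 * (T + 1)\<close>.\<close>

lemma uniform_loops:
  fixes h :: "'s \<Rightarrow> 's \<Rightarrow> int ^ 'd"
  assumes loops: "\<And>v. \<exists>n\<ge>1. wpath C h n v a a" and F: "finite F"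
  shows "\<exists>c\<ge>1. \<exists>L\<ge>1. \<forall>v\<in>F. wpath C h L (int c *s v) a a"
proof -
  obtain \<nu> where \<nu>: "\<And>v. \<nu> v \<ge> 1" "\<And>v. wpath C h (\<nu> v) v a a" using loops by metis
  have "finite (\<nu> ` F)" using F by simp
  then obtain T where T: "\<forall>n\<in>\<nu> ` F. n \<le> T" unfolding finite_nat_set_iff_bounded_le by blast
  have "wpath C h (\<nu> 0 * (T + 1)) (int (\<nu> 0) *s v) a a" if "v \<in> F" for v
  proof -
    have "\<nu> v \<le> T" using T that by blast
    have "wpath C h (\<nu> 0 * \<nu> v + (T + 1 - \<nu> v) * \<nu> 0) (int (\<nu> 0) *s v + int (T + 1 - \<nu> v) *s 0) a a"
      by (intro wpath_trans[OF wpath_power wpath_power] \<nu>)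
    moreover have "\<nu> 0 * \<nu> v + (T + 1 - \<nu> v) * \<nu> 0 = \<nu> 0 * (\<nu> v + (T + 1 - \<nu> v))"
      by (simp only: distrib_left mult.commute)
    moreover have "\<nu> v + (T + 1 - \<nu> v) = T + 1" using \<open>\<nu> v \<le> T\<close> by simp
    moreover have "int (\<nu> 0) *s v + int (T + 1 - \<nu> v) *s 0 = int (\<nu> 0) *s v" by simp
    ultimately show ?thesis by (simp only:)
  qed
  moreover have "\<nu> 0 * (T + 1) \<ge> 1" using \<nu>(1)[of 0] by (cases "\<nu> 0") auto
  ultimately show ?thesis using \<nu>(1) by blast
qed

lemma abs_hsum_le:
  assumes "\<And>a b. \<bar>h a b $ j\<bar> \<le> B"
  shows "\<bar>hsum h s n $ j\<bar> \<le> int n * B"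
proof (induction n)
  case (Suc n)
  have "\<bar>hsum h s (Suc n) $ j\<bar> \<le> \<bar>hsum h s n $ j\<bar> + \<bar>h (s (int n)) (s (int n + 1)) $ j\<bar>"
    by (simp add: hsum_Suc)
  also have "\<dots> \<le> int n * B + B" using Suc assms add_mono by blast
  finally show ?case by (simp add: algebra_simps)
qed simp

text \<open>Concatenating loops of weights \<open>c (\<lfloor>(k+1) r\<rfloor> - \<lfloor>k r\<rfloor>)\<close> and common length \<open>L\<close> gives
  an orbit whose cocycle stays within bounded distance of the line through \<open>c r / L\<close>.\<close>
lemma scaled_in_rot_set:
  fixes h :: "'s::finite \<Rightarrow> 's \<Rightarrow> int ^ 'd" and r :: "real ^ 'd"
  assumes L: "L \<ge> 1" and r: "\<And>j. \<bar>r $ j\<bar> < 1"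
    and loops: "\<And>v. (\<And>j. \<bar>v $ j\<bar> \<le> 1) \<Longrightarrow> wpath C h L (int c *s v) a a"
  shows "(real c / real L) *\<^sub>R r \<in> rot_set C h"
proof -
  define f where "f k = (\<chi> j. \<lfloor>real_of_int k * r $ j\<rfloor>)" for k :: int
  define V where "V k = f (k + 1) - f k" for k
  \<comment> \<open>As the entries of \<open>r\<close> are less than 1 in absolute value,
    consecutive floors differ by at most 1, so the available loops suffice.\<close>
  have V1: "\<bar>V k $ j\<bar> \<le> 1" for k j
  proof -
    have "real_of_int (k + 1) * r $ j = real_of_int k * r $ j + r $ j" by (simp add: algebra_simps)
    then show ?thesis unfolding V_def f_def using r[of j] by simp linarith
  qed
  have "\<forall>k. \<exists>g :: int \<Rightarrow> 's. g 0 = a \<and> g (int L) = a \<and>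
      (\<forall>i. 0 \<le> i \<and> i < int L \<longrightarrow> C (g i) (g (i + 1))) \<and> hsum h g L = int c *s V k"
    using loops[OF V1] unfolding wpath_def by blast
  from choice[OF this] obtain G :: "int \<Rightarrow> int \<Rightarrow> 's" where
    G: "\<And>k. G k 0 = a" "\<And>k. G k (int L) = a"
      "\<And>k i. 0 \<le> i \<Longrightarrow> i < int L \<Longrightarrow> C (G k i) (G k (i + 1))"
      "\<And>k. hsum h (G k) L = int c *s V k" by blast
  have "\<exists>s\<in>SFT C. (\<forall>k i. 0 \<le> i \<longrightarrow> i \<le> int L \<longrightarrow> s (k * int L + i) = G k i) \<and>
      (\<forall>k. hsum h s (k * L) = (\<Sum>j<k. hsum h (G (int j)) L))"
    by (rule concat_loops[of L G a]) (use L G in simp_all)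
  then obtain s where s: "s \<in> SFT C" and "\<And>k. hsum h s (k * L) = (\<Sum>j<k. hsum h (G (int j)) L)"
    by blast
  \<comment> \<open>The increments \<open>V\<close> telescope, and \<open>f 0 = 0\<close>.\<close>
  moreover have "(\<Sum>j<k. hsum h (G (int j)) L) = int c *s f (int k)" for k
    by (induction k) (auto simp: G(4) V_def f_def vec_eq_iff algebra_simps)
  ultimately have sL: "hsum h s (k * L) = int c *s f (int k)" for k by simp
  have lim: "(\<lambda>n. real_of_int (hsum h s n $ j) / real n) \<longlonglongrightarrow> real c / real L * r $ j" for j
  proof -
    define B where "B = (\<Sum>a\<in>UNIV. \<Sum>b\<in>UNIV. \<bar>h a b $ j\<bar>)"
    have B: "\<bar>h a b $ j\<bar> \<le> B" for a b
    proof -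
      have "\<bar>h a b $ j\<bar> \<le> (\<Sum>b\<in>UNIV. \<bar>h a b $ j\<bar>)"
        by (rule member_le_sum[of b UNIV "\<lambda>b. \<bar>h a b $ j\<bar>"]) auto
      also have "\<dots> \<le> B" unfolding B_def
        by (rule member_le_sum[of a UNIV "\<lambda>a. \<Sum>b\<in>UNIV. \<bar>h a b $ j\<bar>"]) (auto intro: sum_nonneg)
      finally show ?thesis .
    qed
    have B0: "B \<ge> 0" using B[of a a] by linarith
    \<comment> \<open>The three terms bound the rounding by the floor, the drift of the line over
      the incomplete last block, and the weight of that block.\<close>
    define K where "K = real c + real c + real L * real_of_int B"
    have K: "\<bar>real_of_int (hsum h s n $ j) - real n * (real c / real L * r $ j)\<bar> \<le> K" for n
    proof -
      define k where "k = n div L"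
      define \<rho> where "\<rho> = n mod L"
      have n: "n = k * L + \<rho>" and \<rho>: "\<rho> \<le> L" using L by (simp_all add: k_def \<rho>_def order_less_imp_le)
      define e where "e = real_of_int (hsum h (\<lambda>i. s (i + int (k * L))) \<rho> $ j)"
      have "\<bar>hsum h (\<lambda>i. s (i + int (k * L))) \<rho> $ j\<bar> \<le> int \<rho> * B" by (rule abs_hsum_le) (rule B)
      also have "\<dots> \<le> int L * B" using \<rho> B0 by (simp add: mult_right_mono)
      finally have e: "\<bar>e\<bar> \<le> real L * real_of_int B" unfolding e_def
        by (metis of_int_abs of_int_le_iff of_int_mult of_int_of_nat_eq)
      have "real_of_int (hsum h s n $ j) = real c * real_of_int \<lfloor>real k * r $ j\<rfloor> + e"
        unfolding n hsum_add e_def using sL[of k] by (simp add: f_def)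
      moreover have "real n * (real c / real L * r $ j) =
          real c * (real k * r $ j) + real c * (real \<rho> / real L * r $ j)"
        unfolding n using L by (simp add: field_simps)
      ultimately have eq: "real_of_int (hsum h s n $ j) - real n * (real c / real L * r $ j) =
         e - real c * (real k * r $ j - real_of_int \<lfloor>real k * r $ j\<rfloor>) - real c * (real \<rho> / real L * r $ j)"
        by (simp add: algebra_simps)
      have "\<bar>real c * (real k * r $ j - real_of_int \<lfloor>real k * r $ j\<rfloor>)\<bar> \<le> real c * 1"
        unfolding abs_mult by (intro mult_mono) linarith+
      moreover have "\<bar>real c * (real \<rho> / real L * r $ j)\<bar> \<le> real c * (1 * 1)"
        unfolding abs_mult using \<rho> L r[of j] by (intro mult_mono) (auto simp: field_simps)
      moreover have "\<bar>x - y - z\<bar> \<le> b + b' + b''" if "\<bar>y\<bar> \<le> b * 1" "\<bar>z\<bar> \<le> b' * (1 * 1)" "\<bar>x\<bar> \<le> b''"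
        for x y z b b' b'' :: real using that by linarith
      ultimately show ?thesis unfolding eq K_def using e by blast
    qed
    have "(\<lambda>n. real_of_int (hsum h s n $ j) / real n - real c / real L * r $ j) \<longlonglongrightarrow> 0"
    proof (rule Lim_null_comparison[where g = "\<lambda>n. K / real n"])
      show "\<forall>\<^sub>F n in sequentially. norm (real_of_int (hsum h s n $ j) / real n - real c / real L * r $ j) \<le> K / real n"
        using eventually_gt_at_top[of 0]
      proof eventually_elim
        case (elim n)
        have "real_of_int (hsum h s n $ j) / real n - real c / real L * r $ j =
          (real_of_int (hsum h s n $ j) - real n * (real c / real L * r $ j)) / real n"
          using elim by (simp add: diff_divide_distrib)
        then show ?case using K[of n] elim by (simp add: divide_right_mono)
      qed
      show "(\<lambda>n. K / real n) \<longlonglongrightarrow> 0" by (rule lim_const_over_n)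
    qed
    then show ?thesis by (simp add: LIM_zero_iff)
  qed
  have "(\<lambda>n. (1 / real n) *\<^sub>R real_vec (hsum h s n)) \<longlonglongrightarrow> (real c / real L) *\<^sub>R r"
  proof (rule vec_tendstoI)
    show "(\<lambda>n. ((1 / real n) *\<^sub>R real_vec (hsum h s n)) $ j) \<longlonglongrightarrow> ((real c / real L) *\<^sub>R r) $ j" for j
      using lim[of j] by (simp add: real_vec_def)
  qed
  then show ?thesis unfolding rot_set_def using s by blast
qed

text \<open>Loops of one length \<open>L\<close> and weights \<open>c v\<close>, with
  \<open>v\<close> running through the vectors with entries -1, 0, 1, realise every
  \<open>c r / L\<close> with all entries of \<open>r\<close> less than 1 in absolute value; these
  vectors fill the ball of radius \<open>c / L\<close>.\<close>

lemma interior_rot_if_loops: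
  fixes h :: "'s::finite \<Rightarrow> 's \<Rightarrow> int ^ 'd"
  assumes loops: "\<And>v. \<exists>n\<ge>1. wpath C h n v a a"
  shows "0 \<in> interior (rot_set C h)"
proof -
  define F where "F = {v :: int ^ 'd. \<forall>j. v $ j \<in> {-1..1}}"
  obtain c L where cL: "c \<ge> 1" "L \<ge> 1" "\<And>v. v \<in> F \<Longrightarrow> wpath C h L (int c *s v) a a"
    using uniform_loops[OF loops, of F] finite_int_box unfolding F_def by blast
  have "ball 0 (real c / real L) \<subseteq> rot_set C h"
  proof
    fix x :: "real ^ 'd" assume "x \<in> ball 0 (real c / real L)"
    then have x: "norm x < real c / real L" by simp
    define r where "r = (real L / real c) *\<^sub>R x"
    have r: "\<bar>r $ j\<bar> < 1" for j
    proof -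
      have "\<bar>x $ j\<bar> < real c / real L" using x component_le_norm_cart[of x j] by linarith
      then show ?thesis using cL(1,2) by (simp add: r_def abs_mult field_simps)
    qed
    have "wpath C h L (int c *s v) a a" if "\<And>j. \<bar>v $ j\<bar> \<le> 1" for v
      using that by (intro cL(3)) (auto simp: F_def abs_le_iff minus_le_iff)
    with cL(2) r have "(real c / real L) *\<^sub>R r \<in> rot_set C h" by (rule scaled_in_rot_set)
    moreover have "(real c / real L) *\<^sub>R r = x" using cL(1,2) by (simp add: r_def)
    ultimately show "x \<in> rot_set C h" by simp
  qed
  moreover have "0 < real c / real L" using cL(1,2) by simp
  ultimately show ?thesis by (meson mem_interior)
qed

section \<open>The implications from (a) to (b) and (c), from (b) to (a), and from (c) to
  (a)\<close>

theorem mainTheorem4: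
  fixes C :: "'s::finite \<Rightarrow> 's \<Rightarrow> bool" and h0 :: "'s \<Rightarrow> 's \<Rightarrow> int ^ 'd"
  assumes base_trans: "dyn_transitive (SFT_top C) lshift"
    and infinite: "infinite (SFT C)"
  shows "(dyn_transitive (skew_top C) (skew h0) \<longleftrightarrow>
            ftp C h0 \<and> (0::real ^ 'd) \<in> interior (rot_set C h0))
       \<and> (dyn_transitive (skew_top C) (skew h0) \<longleftrightarrow>
            ftp C h0 \<and> (skew_top C) closure_of (periodic_pts C h0) = topspace (skew_top C))"
proof -
  \<comment> \<open>Each of the three conditions contains or implies the ftp, so the absence of
    isolated points is available in every implication.\<close>
  have perfect: "perfect_SFT C" if "ftp C h0"
    using perfect_SFT_if_ftp[OF base_trans infinite that] .

  have a_bc: "ftp C h0 \<and> 0 \<in> interior (rot_set C h0) \<and>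
      (skew_top C) closure_of (periodic_pts C h0) = topspace (skew_top C)"
    if a: "dyn_transitive (skew_top C) (skew h0)"
  proof -
    have ftp: "ftp C h0" using ftp_of_dyn_transitive[OF a] .
    obtain s where s: "s \<in> SFT C" using infinite by (metis ex_in_conv finite.emptyI)
    have "0 \<in> interior (rot_set C h0)"
      by (rule interior_rot_if_loops) (rule wpath_if_transitive[OF perfect[OF ftp] a s s])
    moreover have "(skew_top C) closure_of (periodic_pts C h0) = topspace (skew_top C)"
      unfolding dense_periodic_iff using dense_periodic_if_transitive[OF perfect[OF ftp] a] by blast
    ultimately show ?thesis using ftp by blast
  qed
  have b_a: "dyn_transitive (skew_top C) (skew h0)"
    if ftp: "ftp C h0" and int: "0 \<in> interior (rot_set C h0)"
  proof (rule transitive_if_opposite[OF perfect[OF ftp] ftp])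
    have conn: "\<exists>n w. wpath C h0 n w (s 0) (t 0)" if "s \<in> SFT C" "t \<in> SFT C" for s t
      using wpath_if_ftp[OF perfect[OF ftp] ftp that zero_less_one] by blast
    show "\<exists>k n m'. wpath C h0 n m' (s 0) (s 0) \<and> (\<forall>j. \<bar>(m' + int k *s m) $ j\<bar> < int k)"
      if "s \<in> SFT C" for s m
      using int conn that by (rule opposite_loop_if_interior_rot)
  qed
  have c_a: "dyn_transitive (skew_top C) (skew h0)"
    if ftp: "ftp C h0" and dense: "(skew_top C) closure_of (periodic_pts C h0) = topspace (skew_top C)"
  proof (rule transitive_if_opposite[OF perfect[OF ftp] ftp])
    fix s n m assume loop: "wpath C h0 n m (s 0) (s 0)" "n \<ge> 1"
    have "\<exists>u\<in>cyl C t N. (u, 0) \<in> periodic_pts C h0" if "t \<in> SFT C" for t N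
      using dense that unfolding dense_periodic_iff by blast
    from opposite_loop_if_dense_periodic[OF this loop]
    obtain n' where "wpath C h0 n' (- m) (s 0) (s 0)" by blast
    then show "\<exists>k n m'. wpath C h0 n m' (s 0) (s 0) \<and> (\<forall>j. \<bar>(m' + int k *s m) $ j\<bar> < int k)"
      \<comment> \<open>The weights \<open>- m\<close> and \<open>m\<close> cancel exactly, so
        \<open>k = 1\<close> is enough.\<close>
      by (intro exI[of _ 1] exI[of _ n'] exI[of _ "- m"]) simp
  qed
  show ?thesis using a_bc b_a c_a by blast
qed

end
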